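(* Let $m\in\mathbb N^*$ be fixed and known. Let $S$ be the $p\times p$ empirical covariance matrix (assumed positive definite) and $\widehat C$ the associated empirical correlation matrix. Let $s$ be the smallest integer such that all groups of $B_{s/p}$ have cardinality at most $m$, let $A_s=\{s/p,(s+1)/p,\dots,(p-1)/p,1\}$, and let $\widehat B_s$ be a minimizer of $\Psi$ over $\{B_\lambda:\lambda\in A_s\}$. The computational complexity of $\widehat B_s$ is $O(p^2)$: given $S$, it can be computed with $O(p^2)$ elementary operations (the constant depending on $m$).
   Context: $S=(s_{ij})=\frac1n\sum_{l=1}^n(X^{(l)}-\overline X)(X^{(l)}-\overline X)^T$ is the empirical covariance matrix of a sample $X^{(1)},\dots,X^{(n)}$ in $\mathbb R^p$, with $\overline X=\frac1n\sum_lX^{(l)}$, and $\widehat C_{ij}=s_{ij}/\sqrt{s_{ii}s_{jj}}$. Elementary operations are unit-cost operations on reals (arithmetic, comparisons, square roots, logarithms) and on indices. For a partition $B$ of $\{1,\dots,p\}$ and a symmetric matrix $\Gamma$, $\Gamma_B$ has entries $\gamma_{ij}$ when $i,j$ are in the same element of $B$ and $0$ otherwise; $B(\Gamma)$ is the unique finest partition $B$ with $\Gamma=\Gamma_B$ (the connected components of the graph of nonzero entries). For $\lambda\in[0,1]$, $B_\lambda=B((\widehat C_{ij}\mathbf 1_{|\widehat C_{ij}|>\lambda})_{i,j\le p})$. For $\Gamma$ symmetric positive definite, $l_\Gamma=\frac1p(\log|\Gamma|+\mathrm{Tr}(\Gamma^{-1}S))$, $\mathrm{pen}(\Gamma)=\sum_{k=1}^Kp_k^2$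 if $B(\Gamma)=\{B_1,\dots,B_K\}$ with $|B_k|=p_k$, $\Phi(\Gamma)=l_\Gamma+\kappa\,\mathrm{pen}(\Gamma)$ with a given $\kappa\ge0$ (in the paper $\kappa=1/(pn^\delta)$), and $\Psi(B)=\Phi(S_B)$. *)

theory Defs
  imports
    Complex_Main
    "HOL-Library.Disjoint_Sets"
    "HOL-Library.Landau_Symbols"
    "Jordan_Normal_Form.Determinant"
    "Jordan_Normal_Form.Gauss_Jordan_Elimination"
begin

text \<open>Variables are indexed by \<open>{0..<p}\<close> instead of \<open>{1,...,p}\<close>, observations by \<open>{..<n}\<close>.\<close>

section \<open>Empirical covariance and correlation\<close>

definition sample_mean :: "nat \<Rightarrow> nat \<Rightarrow> (nat \<Rightarrow> real vec) \<Rightarrow> real vec" where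
  "sample_mean p n X = vec p (\<lambda>i. (\<Sum>l<n. X l $ i) / real n)"

definition emp_cov :: "nat \<Rightarrow> nat \<Rightarrow> (nat \<Rightarrow> real vec) \<Rightarrow> real mat" where
  "emp_cov p n X = mat p p (\<lambda>(i, j).
     (\<Sum>l<n. (X l - sample_mean p n X) $ i * (X l - sample_mean p n X) $ j) / real n)"

definition emp_corr :: "real mat \<Rightarrow> real mat" where
  "emp_corr S = mat (dim_row S) (dim_row S)
     (\<lambda>(i, j). S $$ (i, j) / sqrt (S $$ (i, i) * S $$ (j, j)))"

definition pos_def_mat :: "real mat \<Rightarrow> bool" where
  "pos_def_mat A \<longleftrightarrow> square_mat A \<and> transpose_mat A = A \<and>
     (\<forall>v \<in> carrier_vec (dim_row A). v \<noteq> 0\<^sub>v (dim_row A) \<longrightarrow> 0 < v \<bullet> (A *\<^sub>v v))"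

definition mat_trace :: "real mat \<Rightarrow> real" where
  "mat_trace A = (\<Sum>i<dim_row A. A $$ (i, i))"

section \<open>Block structures\<close>

definition block_restrict :: "real mat \<Rightarrow> nat set set \<Rightarrow> real mat" where
  "block_restrict A B = mat (dim_row A) (dim_row A)
     (\<lambda>(i, j). if \<exists>b\<in>B. i \<in> b \<and> j \<in> b then A $$ (i, j) else 0)"

definition block_structure :: "real mat \<Rightarrow> nat set set" where
  "block_structure A = (THE B.
     partition_on {0..<dim_row A} B \<and> block_restrict A B = A \<and>
     (\<forall>B'. partition_on {0..<dim_row A} B' \<and> block_restrict A B' = A \<longrightarrow>
        refines {0..<dim_row A} B B'))"

text \<open>The description is proper, and it yields the connected components of the graph of nonzero
  entries.\<close>

definition conn_rel :: "real mat \<Rightarrow> (nat \<times> nat) set" where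
  "conn_rel A = (let E = {(i, j). i < dim_row A \<and> j < dim_row A \<and> A $$ (i, j) \<noteq> 0} in
     (E \<union> E\<inverse>)\<^sup>* \<inter> {0..<dim_row A} \<times> {0..<dim_row A})"

lemma equiv_conn_rel: "equiv {0..<dim_row A} (conn_rel A)"
proof -
  let ?E = "{(i, j). i < dim_row A \<and> j < dim_row A \<and> A $$ (i, j) \<noteq> 0}"
  have "sym (?E \<union> ?E\<inverse>)" by (rule sym_Un_converse)
  then have "sym ((?E \<union> ?E\<inverse>)\<^sup>*)" by (rule sym_rtrancl)
  then have "sym (conn_rel A)"
    unfolding conn_rel_def Let_def by (auto simp: sym_def)
  moreover have "trans (conn_rel A)"
    unfolding conn_rel_def Let_def by (rule transI) (auto intro: rtrancl_trans)
  moreover have "refl_on {0..<dim_row A} (conn_rel A)"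
    unfolding conn_rel_def Let_def refl_on_def by auto
  moreover have "conn_rel A \<subseteq> {0..<dim_row A} \<times> {0..<dim_row A}"
    unfolding conn_rel_def Let_def by auto
  ultimately show ?thesis by (simp add: equiv_def)
qed

lemma block_structure_eq_components:
  assumes "square_mat A"
  shows "block_structure A = {0..<dim_row A} // conn_rel A"
proof -
  define p where "p = dim_row A"
  define E where "E = {(i, j). i < p \<and> j < p \<and> A $$ (i, j) \<noteq> 0}"
  define R where "R = conn_rel A"
  have R: "R = (E \<union> E\<inverse>)\<^sup>* \<inter> {0..<p} \<times> {0..<p}"
    unfolding R_def conn_rel_def E_def p_def Let_def by simp
  have eq: "equiv {0..<p} R" using equiv_conn_rel[of A] by (simp add: R_def p_def)
  have dims: "dim_row A = p" "dim_col A = p" using assms by (auto simp: p_def)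
  let ?Q = "\<lambda>B. partition_on {0..<p} B \<and> block_restrict A B = A"
  have part: "partition_on {0..<p} ({0..<p} // R)"
    using eq by (rule partition_on_quotient)
  have "block_restrict A ({0..<p} // R) = A"
  proof (rule eq_matI)
    fix i j assume ij: "i < dim_row A" "j < dim_col A"
    have "\<exists>b\<in>{0..<p} // R. i \<in> b \<and> j \<in> b" if "A $$ (i, j) \<noteq> 0"
    proof -
      have "(i, j) \<in> E" using that ij dims by (auto simp: E_def)
      then have "(i, j) \<in> R" using ij dims by (auto simp: R)
      moreover have "(i, i) \<in> R" using ij dims by (auto simp: R)
      moreover have "R `` {i} \<in> {0..<p} // R" using ij dims by (auto intro: quotientI)
      ultimately show ?thesis by blast
    qed
    then show "block_restrict A ({0..<p} // R) $$ (i, j) = A $$ (i, j)"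
      using ij dims unfolding block_restrict_def by auto
  qed (auto simp: block_restrict_def dims)
  with part have Q: "?Q ({0..<p} // R)" by simp
  have fin: "refines {0..<p} ({0..<p} // R) B'" if B': "?Q B'" for B'
    unfolding refines_def
  proof (intro conjI ballI)
    show "partition_on {0..<p} B'" "partition_on {0..<p} ({0..<p} // R)"
      using B' part by auto
    have step: "j \<in> b" if "(i, j) \<in> E \<union> E\<inverse>" "i \<in> b" "b \<in> B'" for i j b
    proof -
      have *: "\<exists>c\<in>B'. k \<in> c \<and> l \<in> c" if "(k, l) \<in> E" for k l
      proof (rule ccontr)
        assume n: "\<not> (\<exists>c\<in>B'. k \<in> c \<and> l \<in> c)"
        have kl: "k < p" "l < p" "A $$ (k, l) \<noteq> 0" using that by (auto simp: E_def)
        have "block_restrict A B' $$ (k, l) = 0"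
          using n kl dims unfolding block_restrict_def by simp
        then show False using B' kl by simp
      qed
      obtain c where "c \<in> B'" "i \<in> c" "j \<in> c" using \<open>(i, j) \<in> E \<union> E\<inverse>\<close> * by blast
      moreover have "c = b"
        using B' calculation that unfolding partition_on_def disjoint_def by blast
      ultimately show ?thesis by simp
    qed
    fix b assume "b \<in> {0..<p} // R"
    then obtain i where i: "i < p" "b = R `` {i}" by (auto elim: quotientE)
    then have "i \<in> \<Union>B'" using B' by (simp add: partition_on_def)
    then obtain c where c: "c \<in> B'" "i \<in> c" by blast
    have "j \<in> c" if "(i, j) \<in> (E \<union> E\<inverse>)\<^sup>*" for j
      using that by (induction rule: rtrancl_induct) (use c step in auto)
    then show "\<exists>Y\<in>B'. b \<subseteq> Y" using c i by (auto simp: R)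
  qed
  have "block_structure A = (THE B. ?Q B \<and> (\<forall>B'. ?Q B' \<longrightarrow> refines {0..<p} B B'))"
    unfolding block_structure_def p_def by (simp only: conj_assoc)
  also have "\<dots> = {0..<p} // R"
    by (rule the_equality) (use Q fin refines_asym in blast)+
  finally show ?thesis by (simp add: p_def R_def)
qed

definition corr_threshold :: "real mat \<Rightarrow> real \<Rightarrow> real mat" where
  "corr_threshold C lam = mat (dim_row C) (dim_row C)
     (\<lambda>(i, j). if \<bar>C $$ (i, j)\<bar> > lam then C $$ (i, j) else 0)"

definition threshold_partition :: "real mat \<Rightarrow> real \<Rightarrow> nat set set" where
  "threshold_partition S lam = block_structure (corr_threshold (emp_corr S) lam)"

section \<open>The penalised criterion and the candidate thresholds\<close>

definition neg_loglik :: "real mat \<Rightarrow> real mat \<Rightarrow> real" where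
  "neg_loglik S A =
     (ln (det A) + mat_trace (the (mat_inverse A) * S)) / real (dim_row S)"

definition pen :: "real mat \<Rightarrow> real" where
  "pen A = (\<Sum>b\<in>block_structure A. (real (card b))\<^sup>2)"

definition crit_mat :: "real \<Rightarrow> real mat \<Rightarrow> real mat \<Rightarrow> real" where
  "crit_mat \<kappa> S A = neg_loglik S A + \<kappa> * pen A"

definition crit :: "real \<Rightarrow> real mat \<Rightarrow> nat set set \<Rightarrow> real" where
  "crit \<kappa> S B = crit_mat \<kappa> S (block_restrict S B)"

definition start_index :: "nat \<Rightarrow> real mat \<Rightarrow> nat" where
  "start_index m S = (LEAST s.
     \<forall>b \<in> threshold_partition S (real s / real (dim_row S)). card b \<le> m)"

definition threshold_grid :: "nat \<Rightarrow> real mat \<Rightarrow> real set" where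
  "threshold_grid m S = {real k / real (dim_row S) | k. start_index m S \<le> k \<and> k \<le> dim_row S}"

definition is_block_estimate :: "nat \<Rightarrow> real \<Rightarrow> real mat \<Rightarrow> nat set set \<Rightarrow> bool" where
  "is_block_estimate m \<kappa> S B \<longleftrightarrow>
     is_arg_min (crit \<kappa> S) (\<lambda>B. B \<in> threshold_partition S ` threshold_grid m S) B"

section \<open>A real random access machine with unit-cost operations\<close>

text \<open>
  Programs are finite while programs over index (natural number) and real variables and
  two-dimensional index and real arrays, all named by natural numbers.  Array positions are
  computed at run time; names are not, so a program has a fixed finite set of variables and arrays.
  There are only natural number constants, and there is neither a rounding operation nor any other
  passage from reals to indices than branching on comparisons.
  Outside their usual domain \<open>/\<close>, \<open>sqrt\<close> and \<open>ln\<close> keep their HOL values (\<open>x / 0 = 0\<close>,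
  \<open>sqrt (- x) = - sqrt x\<close>, \<open>ln 0 = 0\<close>, \<open>ln (- x) = ln x\<close>), which the proper partial operations
  provide after a bounded number of comparisons.
\<close>

record store =
  ivar :: "nat \<Rightarrow> nat"
  rvar :: "nat \<Rightarrow> real"
  iarr :: "nat \<Rightarrow> nat \<Rightarrow> nat \<Rightarrow> nat"
  rarr :: "nat \<Rightarrow> nat \<Rightarrow> nat \<Rightarrow> real"

datatype iexp =
    ICon nat
  | IVar nat
  | IGet nat iexp iexp
  | IAdd iexp iexp
  | ISub iexp iexp

datatype rexp =
    ROfIndex iexp
  | RVar nat
  | RGet nat iexp iexp
  | RAdd rexp rexp
  | RSub rexp rexp
  | RMul rexp rexp
  | RDiv rexp rexp
  | RSqrt rexp
  | RLn rexp

datatype bexp =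
    ILess iexp iexp
  | IEq iexp iexp
  | RLess rexp rexp
  | REq rexp rexp
  | BNot bexp
  | BAnd bexp bexp

datatype com =
    Skip
  | ISet nat iexp
  | RSet nat rexp
  | IPut nat iexp iexp iexp
  | RPut nat iexp iexp rexp
  | Seq com com
  | Cond bexp com com
  | While bexp com

primrec ival :: "iexp \<Rightarrow> store \<Rightarrow> nat" where
  "ival (ICon k) \<sigma> = k"
| "ival (IVar x) \<sigma> = ivar \<sigma> x"
| "ival (IGet a d e) \<sigma> = iarr \<sigma> a (ival d \<sigma>) (ival e \<sigma>)"
| "ival (IAdd d e) \<sigma> = ival d \<sigma> + ival e \<sigma>"
| "ival (ISub d e) \<sigma> = ival d \<sigma> - ival e \<sigma>"

primrec rval :: "rexp \<Rightarrow> store \<Rightarrow> real" where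
  "rval (ROfIndex e) \<sigma> = real (ival e \<sigma>)"
| "rval (RVar x) \<sigma> = rvar \<sigma> x"
| "rval (RGet a d e) \<sigma> = rarr \<sigma> a (ival d \<sigma>) (ival e \<sigma>)"
| "rval (RAdd d e) \<sigma> = rval d \<sigma> + rval e \<sigma>"
| "rval (RSub d e) \<sigma> = rval d \<sigma> - rval e \<sigma>"
| "rval (RMul d e) \<sigma> = rval d \<sigma> * rval e \<sigma>"
| "rval (RDiv d e) \<sigma> = rval d \<sigma> / rval e \<sigma>"
| "rval (RSqrt e) \<sigma> = sqrt (rval e \<sigma>)"
| "rval (RLn e) \<sigma> = ln (rval e \<sigma>)"

primrec bval :: "bexp \<Rightarrow> store \<Rightarrow> bool" where
  "bval (ILess d e) \<sigma> \<longleftrightarrow> ival d \<sigma> < ival e \<sigma>"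
| "bval (IEq d e) \<sigma> \<longleftrightarrow> ival d \<sigma> = ival e \<sigma>"
| "bval (RLess d e) \<sigma> \<longleftrightarrow> rval d \<sigma> < rval e \<sigma>"
| "bval (REq d e) \<sigma> \<longleftrightarrow> rval d \<sigma> = rval e \<sigma>"
| "bval (BNot b) \<sigma> \<longleftrightarrow> \<not> bval b \<sigma>"
| "bval (BAnd b c) \<sigma> \<longleftrightarrow> bval b \<sigma> \<and> bval c \<sigma>"

primrec icost :: "iexp \<Rightarrow> nat" where
  "icost (ICon k) = 1"
| "icost (IVar x) = 1"
| "icost (IGet a d e) = 1 + icost d + icost e"
| "icost (IAdd d e) = 1 + icost d + icost e"
| "icost (ISub d e) = 1 + icost d + icost e"

primrec rcost :: "rexp \<Rightarrow> nat" where
  "rcost (ROfIndex e) = 1 + icost e"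
| "rcost (RVar x) = 1"
| "rcost (RGet a d e) = 1 + icost d + icost e"
| "rcost (RAdd d e) = 1 + rcost d + rcost e"
| "rcost (RSub d e) = 1 + rcost d + rcost e"
| "rcost (RMul d e) = 1 + rcost d + rcost e"
| "rcost (RDiv d e) = 1 + rcost d + rcost e"
| "rcost (RSqrt e) = 1 + rcost e"
| "rcost (RLn e) = 1 + rcost e"

primrec bcost :: "bexp \<Rightarrow> nat" where
  "bcost (ILess d e) = 1 + icost d + icost e"
| "bcost (IEq d e) = 1 + icost d + icost e"
| "bcost (RLess d e) = 1 + rcost d + rcost e"
| "bcost (REq d e) = 1 + rcost d + rcost e"
| "bcost (BNot b) = 1 + bcost b"
| "bcost (BAnd b c) = 1 + bcost b + bcost c"

definition iarr_upd :: "nat \<Rightarrow> nat \<Rightarrow> nat \<Rightarrow> nat \<Rightarrow> store \<Rightarrow> store" where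
  "iarr_upd a i j v \<sigma> = \<sigma>\<lparr>iarr := (iarr \<sigma>)(a := (iarr \<sigma> a)(i := (iarr \<sigma> a i)(j := v)))\<rparr>"

definition rarr_upd :: "nat \<Rightarrow> nat \<Rightarrow> nat \<Rightarrow> real \<Rightarrow> store \<Rightarrow> store" where
  "rarr_upd a i j v \<sigma> = \<sigma>\<lparr>rarr := (rarr \<sigma>)(a := (rarr \<sigma> a)(i := (rarr \<sigma> a i)(j := v)))\<rparr>"

text \<open>\<open>exec c \<sigma> t \<sigma>'\<close>: started in \<open>\<sigma>\<close>, \<open>c\<close> halts in \<open>\<sigma>'\<close> after \<open>t\<close> elementary operations.\<close>

inductive exec :: "com \<Rightarrow> store \<Rightarrow> nat \<Rightarrow> store \<Rightarrow> bool" where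
  Skip: "exec Skip \<sigma> 1 \<sigma>"
| ISet: "exec (ISet x e) \<sigma> (1 + icost e) (\<sigma>\<lparr>ivar := (ivar \<sigma>)(x := ival e \<sigma>)\<rparr>)"
| RSet: "exec (RSet x e) \<sigma> (1 + rcost e) (\<sigma>\<lparr>rvar := (rvar \<sigma>)(x := rval e \<sigma>)\<rparr>)"
| IPut: "exec (IPut a d e f) \<sigma> (1 + icost d + icost e + icost f)
    (iarr_upd a (ival d \<sigma>) (ival e \<sigma>) (ival f \<sigma>) \<sigma>)"
| RPut: "exec (RPut a d e f) \<sigma> (1 + icost d + icost e + rcost f)
    (rarr_upd a (ival d \<sigma>) (ival e \<sigma>) (rval f \<sigma>) \<sigma>)"
| Seq: "exec c1 \<sigma> t1 \<sigma>1 \<Longrightarrow> exec c2 \<sigma>1 t2 \<sigma>2 \<Longrightarrow> exec (Seq c1 c2) \<sigma> (t1 + t2) \<sigma>2"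
| CondTrue: "bval b \<sigma> \<Longrightarrow> exec c1 \<sigma> t \<sigma>1 \<Longrightarrow> exec (Cond b c1 c2) \<sigma> (1 + bcost b + t) \<sigma>1"
| CondFalse: "\<not> bval b \<sigma> \<Longrightarrow> exec c2 \<sigma> t \<sigma>1 \<Longrightarrow> exec (Cond b c1 c2) \<sigma> (1 + bcost b + t) \<sigma>1"
| WhileFalse: "\<not> bval b \<sigma> \<Longrightarrow> exec (While b c) \<sigma> (1 + bcost b) \<sigma>"
| WhileTrue: "bval b \<sigma> \<Longrightarrow> exec c \<sigma> t1 \<sigma>1 \<Longrightarrow> exec (While b c) \<sigma>1 t2 \<sigma>2 \<Longrightarrow>
    exec (While b c) \<sigma> (1 + bcost b + t1 + t2) \<sigma>2"

inductive_cases exec_elims: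
  "exec Skip \<sigma> t \<sigma>'"
  "exec (ISet x e) \<sigma> t \<sigma>'"
  "exec (RSet x f) \<sigma> t \<sigma>'"
  "exec (IPut a d e g) \<sigma> t \<sigma>'"
  "exec (RPut a d e f) \<sigma> t \<sigma>'"
  "exec (Seq c1 c2) \<sigma> t \<sigma>'"
  "exec (Cond b c1 c2) \<sigma> t \<sigma>'"
inductive_cases exec_WhileE: "exec (While b c) \<sigma> t \<sigma>'"

lemma exec_deterministic: "exec c \<sigma> t \<sigma>1 \<Longrightarrow> exec c \<sigma> u \<sigma>2 \<Longrightarrow> t = u \<and> \<sigma>1 = \<sigma>2"
proof (induction arbitrary: u \<sigma>2 rule: exec.induct)
  case (Skip \<sigma>)
  then show ?case by (auto elim: exec_elims(1))
next
  case (ISet x e \<sigma>)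
  then show ?case by (auto elim: exec_elims(2))
next
  case (RSet x e \<sigma>)
  then show ?case by (auto elim: exec_elims(3))
next
  case (IPut a d e f \<sigma>)
  then show ?case by (auto elim: exec_elims(4))
next
  case (RPut a d e f \<sigma>)
  then show ?case by (auto elim: exec_elims(5))
next
  case (Seq c1 \<sigma> t1 \<sigma>1 c2 t2 \<sigma>')
  from Seq.prems obtain v1 v2 \<sigma>3 where
    "u = v1 + v2" "exec c1 \<sigma> v1 \<sigma>3" "exec c2 \<sigma>3 v2 \<sigma>2"
    by (rule exec_elims(6))
  with Seq.IH show ?case by metis
next
  case (CondTrue b \<sigma> c1 t \<sigma>1 c2)
  from CondTrue.prems CondTrue.hyps obtain v where
    "u = 1 + bcost b + v" "exec c1 \<sigma> v \<sigma>2"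
    by (auto elim: exec_elims(7))
  with CondTrue.IH show ?case by metis
next
  case (CondFalse b \<sigma> c2 t \<sigma>1 c1)
  from CondFalse.prems CondFalse.hyps obtain v where
    "u = 1 + bcost b + v" "exec c2 \<sigma> v \<sigma>2"
    by (auto elim: exec_elims(7))
  with CondFalse.IH show ?case by metis
next
  case (WhileFalse b \<sigma> c)
  from WhileFalse.prems WhileFalse.hyps show ?case by (cases rule: exec_WhileE) auto
next
  case (WhileTrue b \<sigma> c t1 \<sigma>1 t2 \<sigma>')
  from WhileTrue.prems obtain v1 v2 \<sigma>3 where
    "u = 1 + bcost b + v1 + v2" "exec c \<sigma> v1 \<sigma>3" "exec (While b c) \<sigma>3 v2 \<sigma>2"
    by (rule exec_WhileE) (use WhileTrue.hyps in auto)
  with WhileTrue.IH show ?case by metis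
qed

text \<open>Memory that does not belong to the input may have arbitrary initial contents.\<close>

definition holds_input :: "nat \<Rightarrow> real \<Rightarrow> real mat \<Rightarrow> store \<Rightarrow> bool" where
  "holds_input p \<kappa> S \<sigma> \<longleftrightarrow>
     ivar \<sigma> 0 = p \<and> rvar \<sigma> 0 = \<kappa> \<and> (\<forall>i<p. \<forall>j<p. rarr \<sigma> 0 i j = S $$ (i, j))"

text \<open>A partition is output as an array of labels, equal exactly within the groups.\<close>

definition output_partition :: "nat \<Rightarrow> store \<Rightarrow> nat set set" where
  "output_partition p \<sigma> = (\<lambda>i. {j. j < p \<and> iarr \<sigma> 0 j 0 = iarr \<sigma> 0 i 0}) ` {0..<p}"

end

theory Submission
  imports Defs "HOL-Analysis.L2_Norm"
begin

text \<open>All partitions \<open>B\<^sub>\<lambda>\<close> can be read off a single list, which Prim's algorithm computes with \<open>O(p\<^sup>2)\<close>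
  operations.  Run it on the complete graph on the indices with weights \<open>\<bar>C\<^sub>i\<^sub>j\<bar>\<close>: it always takes
  the vertex with the heaviest edge to the vertices taken before.  Let \<open>\<pi> 0, \<pi> 1, \<dots>\<close> be the
  vertices in the order in which they are taken, and let \<open>w r\<close> be the weight with which \<open>\<pi> r\<close> is
  attached (\<open>w 0 = 0\<close>).  Then the groups of \<open>B\<^sub>\<lambda>\<close> are the maximal runs of consecutive positions,
  the list being cut before every position \<open>r\<close> with \<open>w r \<le> \<lambda>\<close>: at a cut no edge heavier than
  \<open>\<lambda>\<close> leads from the earlier to the later positions, and without a cut the vertex has an edge heavier
  than \<open>\<lambda>\<close> to an earlier vertex, which must lie in the same run (\<open>threshold_partition_eq\<close>).  So
  each of the \<open>p + 1\<close> levels \<open>k / p\<close> costs one linear scan with \<open>p\<close> comparisons, and no correlation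
  ever has to be rounded to a level.

  The scan also computes the criterion.  As \<open>S\<^sub>B\<close> is block diagonal up to a permutation, \<open>ln \<bar>S\<^sub>B\<bar>\<close>
  is a sum over the runs; \<open>Tr (S\<^sub>B\<inverse> S) = p\<close>; and \<open>B(S\<^sub>B) = B\<close> for \<open>B = B\<^sub>\<lambda>\<close>, so that the
  penalty is the sum of the squared lengths of the runs (\<open>crit_label_partition\<close>).  A run longer than
  \<open>m\<close> only disqualifies the level.  The determinant of a shorter run is the value of a fixed
  expression, its Leibniz expansion, whose size depends on \<open>m\<close> alone (\<open>det_expressible\<close>).

  A level above an admissible one is admissible, and level \<open>p\<close> is admissible because correlations have
  modulus at most \<open>1\<close>.  Hence the grid \<open>A\<^sub>s\<close> consists exactly of the admissible levels, and a minimum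
  over these is what is asked for.

  The program nests two loops, each with at most \<open>p + 1\<close> iterations, around steps of bounded cost.  A
  general bound of the cost by a power of the maximal number of iterations, the exponent being the
  nesting depth (\<open>budget_le_power\<close>), then gives \<open>O(p\<^sup>2)\<close>.\<close>

section \<open>Running programs within a budget\<close>

text \<open>The cost of a program all of whose loops make at most \<open>n\<close> iterations each time they are entered;
  both branches of a conditional are paid for.  It depends on the program text and \<open>n\<close> only, which
  keeps cost bookkeeping out of the correctness proofs.\<close>

primrec budget :: "nat \<Rightarrow> com \<Rightarrow> nat" where
  "budget n Skip = 1"
| "budget n (ISet x e) = 1 + icost e"
| "budget n (RSet x e) = 1 + rcost e"
| "budget n (IPut a d e f) = 1 + icost d + icost e + icost f"
| "budget n (RPut a d e f) = 1 + icost d + icost e + rcost f"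
| "budget n (Seq c1 c2) = budget n c1 + budget n c2"
| "budget n (Cond b c1 c2) = 1 + bcost b + budget n c1 + budget n c2"
| "budget n (While b c) = 1 + bcost b + n * (1 + bcost b + budget n c)"

primrec loop_depth :: "com \<Rightarrow> nat" where
  "loop_depth Skip = 0"
| "loop_depth (ISet x e) = 0"
| "loop_depth (RSet x e) = 0"
| "loop_depth (IPut a d e f) = 0"
| "loop_depth (RPut a d e f) = 0"
| "loop_depth (Seq c1 c2) = max (loop_depth c1) (loop_depth c2)"
| "loop_depth (Cond b c1 c2) = max (loop_depth c1) (loop_depth c2)"
| "loop_depth (While b c) = Suc (loop_depth c)"

text \<open>Each loop contributes one factor \<open>n\<close>, so the budget is a polynomial in \<open>n\<close> whose degree is the
  nesting depth.  For \<open>n \<ge> 1\<close> it is at most the sum of its coefficients, which is its value at \<open>1\<close>,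
  times the leading power.\<close>

lemma budget_le_power:
  assumes n: "1 \<le> n"
  shows "budget n c \<le> budget 1 c * n ^ loop_depth c"
proof (induction c)
  case (Seq c1 c2)
  have mono: "k * n ^ d \<le> k * n ^ max d e" "k * n ^ e \<le> k * n ^ max d e" for k d e
    using n by (auto intro!: mult_left_mono power_increasing)
  have "budget n c1 \<le> budget 1 c1 * n ^ max (loop_depth c1) (loop_depth c2)"
    and "budget n c2 \<le> budget 1 c2 * n ^ max (loop_depth c1) (loop_depth c2)"
    using Seq.IH mono le_trans by blast+
  then show ?case by (simp add: add_mult_distrib)
next
  case (Cond b c1 c2)
  have mono: "k * n ^ d \<le> k * n ^ max d e" "k * n ^ e \<le> k * n ^ max d e" for k d e
    using n by (auto intro!: mult_left_mono power_increasing)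
  have "budget n c1 \<le> budget 1 c1 * n ^ max (loop_depth c1) (loop_depth c2)"
    and "budget n c2 \<le> budget 1 c2 * n ^ max (loop_depth c1) (loop_depth c2)"
    using Cond.IH mono le_trans by blast+
  moreover have "1 + bcost b \<le> (1 + bcost b) * n ^ max (loop_depth c1) (loop_depth c2)"
    using mult_left_mono[OF one_le_power[OF n], of "1 + bcost b"] by simp
  ultimately have "1 + bcost b + budget n c1 + budget n c2 \<le>
      (1 + bcost b + budget 1 c1 + budget 1 c2) * n ^ max (loop_depth c1) (loop_depth c2)"
    unfolding add_mult_distrib by linarith
  then show ?case by simp
next
  case (While b c)
  have "n * budget n c \<le> n * (budget 1 c * n ^ loop_depth c)"
    by (rule mult_left_mono[OF While.IH]) simp
  moreover have "1 + bcost b \<le> (1 + bcost b) * n ^ Suc (loop_depth c)"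
    using mult_left_mono[OF one_le_power[OF n, of "Suc (loop_depth c)"], of "1 + bcost b"] by simp
  moreover have "n * (1 + bcost b) \<le> (1 + bcost b) * n ^ Suc (loop_depth c)"
    using mult_left_mono[OF one_le_power[OF n, of "loop_depth c"], of "(1 + bcost b) * n"]
    by (simp add: algebra_simps)
  ultimately have "(1 + bcost b) + n * (1 + bcost b) + n * budget n c \<le>
      (1 + bcost b) * n ^ Suc (loop_depth c) + (1 + bcost b) * n ^ Suc (loop_depth c)
        + n * (budget 1 c * n ^ loop_depth c)"
    by (intro add_mono)
  then show ?case by (simp add: algebra_simps)
qed (use n in simp_all)

text \<open>Total correctness together with the cost bound, in weakest precondition style: the initial store
  is a parameter, so that postconditions can refer to it.\<close>

definition runs :: "nat \<Rightarrow> com \<Rightarrow> store \<Rightarrow> (store \<Rightarrow> bool) \<Rightarrow> bool" where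
  "runs n c \<sigma> Q \<longleftrightarrow> (\<exists>t \<sigma>'. t \<le> budget n c \<and> exec c \<sigma> t \<sigma>' \<and> Q \<sigma>')"

lemma runs_Skip: "Q \<sigma> \<Longrightarrow> runs n Skip \<sigma> Q"
  unfolding runs_def by (intro exI[of _ 1] exI[of _ \<sigma>]) (use exec.Skip in simp)

lemma runs_ISet: "Q (\<sigma>\<lparr>ivar := (ivar \<sigma>)(x := ival e \<sigma>)\<rparr>) \<Longrightarrow> runs n (ISet x e) \<sigma> Q"
  unfolding runs_def by (intro exI[of _ "1 + icost e"] exI conjI, simp, rule exec.ISet)

lemma runs_RSet: "Q (\<sigma>\<lparr>rvar := (rvar \<sigma>)(x := rval e \<sigma>)\<rparr>) \<Longrightarrow> runs n (RSet x e) \<sigma> Q"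
  unfolding runs_def by (intro exI[of _ "1 + rcost e"] exI conjI, simp, rule exec.RSet)

lemma runs_IPut:
  "Q (iarr_upd a (ival d \<sigma>) (ival e \<sigma>) (ival f \<sigma>) \<sigma>) \<Longrightarrow> runs n (IPut a d e f) \<sigma> Q"
  unfolding runs_def by (intro exI[of _ "1 + icost d + icost e + icost f"] exI conjI, simp, rule exec.IPut)

lemma runs_RPut:
  "Q (rarr_upd a (ival d \<sigma>) (ival e \<sigma>) (rval f \<sigma>) \<sigma>) \<Longrightarrow> runs n (RPut a d e f) \<sigma> Q"
  unfolding runs_def by (intro exI[of _ "1 + icost d + icost e + rcost f"] exI conjI, simp, rule exec.RPut)

lemma runs_Seq:
  assumes "runs n c1 \<sigma> (\<lambda>\<tau>. runs n c2 \<tau> Q)"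
  shows "runs n (Seq c1 c2) \<sigma> Q"
proof -
  obtain t1 \<sigma>1 t2 \<sigma>2 where "t1 \<le> budget n c1" "exec c1 \<sigma> t1 \<sigma>1"
    "t2 \<le> budget n c2" "exec c2 \<sigma>1 t2 \<sigma>2" "Q \<sigma>2"
    using assms unfolding runs_def by blast
  then show ?thesis
    unfolding runs_def by (intro exI[of _ "t1 + t2"] exI[of _ \<sigma>2]) (auto intro: exec.Seq)
qed

lemma runs_Cond:
  assumes "bval b \<sigma> \<Longrightarrow> runs n c1 \<sigma> Q" and "\<not> bval b \<sigma> \<Longrightarrow> runs n c2 \<sigma> Q"
  shows "runs n (Cond b c1 c2) \<sigma> Q"
proof (cases "bval b \<sigma>")
  case True
  then obtain t \<tau> where "t \<le> budget n c1" "exec c1 \<sigma> t \<tau>" "Q \<tau>"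
    using assms unfolding runs_def by blast
  with True show ?thesis unfolding runs_def
    by (intro exI[of _ "1 + bcost b + t"] exI[of _ \<tau>]) (auto intro: exec.CondTrue[simplified])
next
  case False
  then obtain t \<tau> where "t \<le> budget n c2" "exec c2 \<sigma> t \<tau>" "Q \<tau>"
    using assms unfolding runs_def by blast
  with False show ?thesis unfolding runs_def
    by (intro exI[of _ "1 + bcost b + t"] exI[of _ \<tau>]) (auto intro: exec.CondFalse[simplified])
qed

text \<open>The counter is reset first, because memory may have arbitrary initial contents.\<close>

definition For :: "nat \<Rightarrow> iexp \<Rightarrow> com \<Rightarrow> com" where
  "For x e c = Seq (ISet x (ICon 0))
     (While (ILess (IVar x) e) (Seq c (ISet x (IAdd (IVar x) (ICon 1)))))"

text \<open>The invariant \<open>I k\<close> is stated for the store in which the counter already has the value \<open>k\<close>.  The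
  body must leave the counter alone, which makes the number of iterations \<open>N\<close>; with \<open>N \<le> n\<close>
  the loop stays within the budget.\<close>

lemma runs_For:
  assumes start: "I 0 (\<sigma>\<lparr>ivar := (ivar \<sigma>)(x := 0)\<rparr>)"
    and step: "\<And>k \<tau>. k < N \<Longrightarrow> I k \<tau> \<Longrightarrow> ivar \<tau> x = k \<Longrightarrow>
      runs n c \<tau> (\<lambda>\<tau>'. ivar \<tau>' x = k \<and> I (Suc k) (\<tau>'\<lparr>ivar := (ivar \<tau>')(x := Suc k)\<rparr>))"
    and bound: "\<And>k \<tau>. I k \<tau> \<Longrightarrow> ival e \<tau> = N"
    and le: "N \<le> n"
    and post: "\<And>\<tau>. I N \<tau> \<Longrightarrow> Q \<tau>"
  shows "runs n (For x e c) \<sigma> Q"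
proof -
  let ?b = "ILess (IVar x) e" and ?c = "Seq c (ISet x (IAdd (IVar x) (ICon 1)))"
  let ?g = "1 + bcost ?b" and ?h = "1 + bcost ?b + budget n ?c"
  have loop: "\<exists>t \<tau>'. t \<le> ?g + (N - k) * ?h \<and> exec (While ?b ?c) \<tau> t \<tau>' \<and> I N \<tau>'"
    if "I k \<tau>" "ivar \<tau> x = k" "k \<le> N" for k \<tau>
    using that
  proof (induction "N - k" arbitrary: k \<tau>)
    case 0
    then have "k = N" "\<not> bval ?b \<tau>" using bound by auto
    then have "exec (While ?b ?c) \<tau> ?g \<tau>" by (intro exec.WhileFalse)
    then show ?case using 0 \<open>k = N\<close> by (intro exI[of _ ?g] exI[of _ \<tau>]) simp
  next
    case (Suc d)
    then have k: "k < N" and b: "bval ?b \<tau>" using bound by auto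
    obtain t \<tau>1 where t: "t \<le> budget n c" "exec c \<tau> t \<tau>1"
      and \<tau>1: "ivar \<tau>1 x = k" "I (Suc k) (\<tau>1\<lparr>ivar := (ivar \<tau>1)(x := Suc k)\<rparr>)"
      using step[OF k Suc.prems(1,2)] unfolding runs_def by blast
    let ?\<tau>2 = "\<tau>1\<lparr>ivar := (ivar \<tau>1)(x := Suc k)\<rparr>"
    have "exec (ISet x (IAdd (IVar x) (ICon 1))) \<tau>1 (1 + icost (IAdd (IVar x) (ICon 1))) ?\<tau>2"
      using exec.ISet[of x "IAdd (IVar x) (ICon 1)" \<tau>1] \<tau>1(1) by simp
    from exec.Seq[OF t(2) this]
    have body: "exec ?c \<tau> (t + (1 + icost (IAdd (IVar x) (ICon 1)))) ?\<tau>2" .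
    have "ivar ?\<tau>2 x = Suc k" "Suc k \<le> N" "d = N - Suc k" using k Suc.hyps(2) by auto
    with Suc.hyps(1)[of "Suc k" ?\<tau>2] \<tau>1(2) obtain u \<tau>3
      where u: "u \<le> ?g + d * ?h" "exec (While ?b ?c) ?\<tau>2 u \<tau>3" "I N \<tau>3" by blast
    have "exec (While ?b ?c) \<tau> (1 + bcost ?b + (t + (1 + icost (IAdd (IVar x) (ICon 1)))) + u) \<tau>3"
      by (rule exec.WhileTrue[OF b body u(2)])
    moreover have "1 + bcost ?b + (t + (1 + icost (IAdd (IVar x) (ICon 1)))) + u
        \<le> ?g + Suc d * ?h"
      using t(1) u(1) by simp
    ultimately show ?case using u(3) Suc.hyps(2) by metis
  qed
  let ?\<sigma> = "\<sigma>\<lparr>ivar := (ivar \<sigma>)(x := 0)\<rparr>"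
  obtain t \<tau> where t: "t \<le> ?g + (N - 0) * ?h" "exec (While ?b ?c) ?\<sigma> t \<tau>" "I N \<tau>"
    using loop[of 0 ?\<sigma>] start by auto
  have "exec (ISet x (ICon 0)) \<sigma> (1 + icost (ICon 0)) ?\<sigma>"
    using exec.ISet[of x "ICon 0" \<sigma>] by simp
  from exec.Seq[OF this t(2)] have "exec (For x e c) \<sigma> (1 + icost (ICon 0) + t) \<tau>"
    unfolding For_def .
  moreover have "(N - 0) * ?h \<le> n * ?h" using le by (intro mult_right_mono) simp_all
  then have "1 + icost (ICon 0) + t \<le> budget n (For x e c)"
    using t(1) unfolding For_def by simp
  ultimately show ?thesis using post[OF t(3)] unfolding runs_def by blast
qed

lemma iarr_upd_simps [simp]:
  "ivar (iarr_upd a i j v \<sigma>) = ivar \<sigma>" "rvar (iarr_upd a i j v \<sigma>) = rvar \<sigma>"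
  "rarr (iarr_upd a i j v \<sigma>) = rarr \<sigma>"
  "iarr (iarr_upd a i j v \<sigma>) a' i' j' =
     (if a' = a \<and> i' = i \<and> j' = j then v else iarr \<sigma> a' i' j')"
  by (simp_all add: iarr_upd_def)

lemma rarr_upd_simps [simp]:
  "ivar (rarr_upd a i j v \<sigma>) = ivar \<sigma>" "rvar (rarr_upd a i j v \<sigma>) = rvar \<sigma>"
  "iarr (rarr_upd a i j v \<sigma>) = iarr \<sigma>"
  "rarr (rarr_upd a i j v \<sigma>) a' i' j' =
     (if a' = a \<and> i' = i \<and> j' = j then v else rarr \<sigma> a' i' j')"
  by (simp_all add: rarr_upd_def)

text \<open>The Leibniz formula is a finite sum of finite products, so for each fixed size the determinant is the
  value of one expression in the entries.  Its cost is a constant of the program.\<close>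

lemma det_expressible:
  fixes E :: "nat \<Rightarrow> nat \<Rightarrow> rexp"
  shows "\<exists>D. \<forall>\<sigma>. rval D \<sigma> = det (mat l l (\<lambda>(i, j). rval (E i j) \<sigma>))"
proof -
  have sum: "\<exists>e. \<forall>\<sigma>. rval e \<sigma> = (\<Sum>x\<in>A. f x \<sigma>)"
    if "finite A" "\<And>x. x \<in> A \<Longrightarrow> \<exists>e. \<forall>\<sigma>. rval e \<sigma> = f x \<sigma>" for A :: "'x set" and f
    using that
  proof (induction A)
    case empty
    show ?case by (rule exI[of _ "ROfIndex (ICon 0)"]) simp
  next
    case (insert x A)
    then obtain e1 e2 where "\<forall>\<sigma>. rval e1 \<sigma> = f x \<sigma>" "\<forall>\<sigma>. rval e2 \<sigma> = (\<Sum>x\<in>A. f x \<sigma>)" by blast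
    with insert.hyps have "\<forall>\<sigma>. rval (RAdd e1 e2) \<sigma> = (\<Sum>x\<in>insert x A. f x \<sigma>)" by simp
    then show ?case by blast
  qed
  have prod: "\<exists>e. \<forall>\<sigma>. rval e \<sigma> = (\<Prod>i = 0..<k. rval (g i) \<sigma>)" for k and g :: "nat \<Rightarrow> rexp"
  proof (induction k)
    case 0
    show ?case by (rule exI[of _ "ROfIndex (ICon 1)"]) simp
  next
    case (Suc k)
    then obtain e where "\<forall>\<sigma>. rval e \<sigma> = (\<Prod>i = 0..<k. rval (g i) \<sigma>)" by blast
    then have "\<forall>\<sigma>. rval (RMul e (g k)) \<sigma> = (\<Prod>i = 0..<Suc k. rval (g i) \<sigma>)" by simp
    then show ?case by blast
  qed
  have "\<exists>e. \<forall>\<sigma>. rval e \<sigma> = signof \<pi> * (\<Prod>i = 0..<l. rval (E i (\<pi> i)) \<sigma>)" for \<pi>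
  proof -
    obtain e where e: "\<forall>\<sigma>. rval e \<sigma> = (\<Prod>i = 0..<l. rval (E i (\<pi> i)) \<sigma>)" using prod[of "\<lambda>i. E i (\<pi> i)"] by blast
    show ?thesis
    proof (cases "sign \<pi> = 1")
      case True
      with e show ?thesis by auto
    next
      case False
      then have "sign \<pi> = -1" by (metis sign_cases)
      with e have "\<forall>\<sigma>. rval (RSub (ROfIndex (ICon 0)) e) \<sigma> =
          signof \<pi> * (\<Prod>i = 0..<l. rval (E i (\<pi> i)) \<sigma>)" by simp
      then show ?thesis by blast
    qed
  qed
  then have "\<exists>e. \<forall>\<sigma>. rval e \<sigma> = (\<Sum>\<pi> \<in> {\<pi>. \<pi> permutes {0..<l}}.
      signof \<pi> * (\<Prod>i = 0..<l. rval (E i (\<pi> i)) \<sigma>))"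
    by (intro sum) (auto intro: finite_permutations)
  then obtain e where e: "\<forall>\<sigma>. rval e \<sigma> = (\<Sum>\<pi> \<in> {\<pi>. \<pi> permutes {0..<l}}.
      signof \<pi> * (\<Prod>i = 0..<l. rval (E i (\<pi> i)) \<sigma>))" by blast
  have "det (mat l l (\<lambda>(i, j). rval (E i j) \<sigma>)) = rval e \<sigma>" for \<sigma>
  proof -
    have "mat l l (\<lambda>(i, j). rval (E i j) \<sigma>) $$ (i, \<pi> i) = rval (E i (\<pi> i)) \<sigma>"
      if "\<pi> permutes {0..<l}" "i \<in> {0..<l}" for \<pi> i
      using that permutes_in_image[OF that(1), of i] by simp
    then show ?thesis
      unfolding e[rule_format] by (subst det_def'[where n = l]) (auto intro!: sum.cong prod.cong)
  qed
  then show ?thesis by metis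
qed

section \<open>Runs between cuts\<close>

text \<open>When a list is cut before the positions in \<open>brk\<close>, this is the first position of the run
  that contains \<open>i\<close>.  Position \<open>0\<close> always starts a run.\<close>

primrec seg_start :: "(nat \<Rightarrow> bool) \<Rightarrow> nat \<Rightarrow> nat" where
  "seg_start brk 0 = 0"
| "seg_start brk (Suc i) = (if brk (Suc i) then Suc i else seg_start brk i)"

lemma seg_start_le: "seg_start brk i \<le> i"
  by (induction i) auto

lemma seg_start_mono_cut:
  "(\<And>i. brk i \<Longrightarrow> brk' i) \<Longrightarrow> seg_start brk i \<le> seg_start brk' i"
proof (induction i)
  case (Suc i)
  then show ?case using seg_start_le[of brk i] by auto
qed simp

lemma seg_start_const:
  "seg_start brk i \<le> j \<Longrightarrow> j \<le> i \<Longrightarrow> seg_start brk j = seg_start brk i"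
proof (induction i)
  case (Suc i)
  then show ?case by (cases "j = Suc i") (auto split: if_splits)
qed simp

lemma seg_start_cut: "seg_start brk i = 0 \<or> brk (seg_start brk i)"
  by (induction i) auto

lemma seg_start_not_cut:
  "seg_start brk i < k \<Longrightarrow> k \<le> i \<Longrightarrow> \<not> brk k"
proof (induction i)
  case (Suc i)
  then show ?case by (cases "k = Suc i") (auto split: if_splits)
qed simp

section \<open>The threshold partitions in the order of Prim\<close>

text \<open>What Prim's algorithm for a maximum spanning tree leaves behind: \<open>w r\<close> is the weight of the
  heaviest edge from \<open>\<pi> r\<close> to earlier vertices, and no vertex that comes later has a heavier one.  The
  value \<open>0\<close> covers the first vertex and vertices without an edge of positive weight.\<close>

definition prim_order :: "nat \<Rightarrow> (nat \<Rightarrow> nat \<Rightarrow> real) \<Rightarrow> (nat \<Rightarrow> nat) \<Rightarrow> (nat \<Rightarrow> real) \<Rightarrow> bool" where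
  "prim_order p c \<pi> w \<longleftrightarrow> bij_betw \<pi> {..<p} {..<p} \<and>
     (\<forall>r<p. w r = 0 \<or> (\<exists>i<r. w r = c (\<pi> i) (\<pi> r))) \<and>
     (\<forall>r<p. \<forall>i<r. \<forall>j. r \<le> j \<and> j < p \<longrightarrow> c (\<pi> i) (\<pi> j) \<le> w r)"

abbreviation cut_at :: "(nat \<Rightarrow> real) \<Rightarrow> real \<Rightarrow> nat \<Rightarrow> bool" where
  "cut_at w lam i \<equiv> \<not> lam < w i"

lemma bij_betw_lessThan:
  assumes "bij_betw \<pi> {..<p} {..<p :: nat}"
  shows "i < p \<Longrightarrow> \<pi> i < p" and "x < p \<Longrightarrow> \<exists>i<p. \<pi> i = x"
proof -
  have "\<pi> ` {..<p} = {..<p}" using assms by (simp add: bij_betw_def)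
  then have *: "x < p \<longleftrightarrow> x \<in> \<pi> ` {..<p}" for x by simp
  show "i < p \<Longrightarrow> \<pi> i < p" using *[of "\<pi> i"] by simp
  show "x < p \<Longrightarrow> \<exists>i<p. \<pi> i = x" using *[of x] by (auto simp: image_iff)
qed

text \<open>The form in which programs output a partition.\<close>

definition label_partition :: "nat \<Rightarrow> (nat \<Rightarrow> nat) \<Rightarrow> nat set set" where
  "label_partition p lab = (\<lambda>i. {j. j < p \<and> lab j = lab i}) ` {0..<p}"

text \<open>Labels that are constant along edges are constant on connected components; if moreover equal labels
  imply connectedness, the label classes are the components.\<close>

lemma block_structure_eq_label_partition:
  assumes sq: "square_mat A" and p: "dim_row A = p"
    and edge: "\<And>i j. i < p \<Longrightarrow> j < p \<Longrightarrow> A $$ (i, j) \<noteq> 0 \<Longrightarrow> lab i = lab j"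
    and conn: "\<And>i j. i < p \<Longrightarrow> j < p \<Longrightarrow> lab i = lab j \<Longrightarrow> (i, j) \<in> conn_rel A"
  shows "block_structure A = label_partition p lab"
proof -
  have lab: "lab i = lab j" if "(i, j) \<in> conn_rel A" for i j
  proof -
    let ?E = "{(i, j). i < p \<and> j < p \<and> A $$ (i, j) \<noteq> 0}"
    have "(i, j) \<in> (?E \<union> ?E\<inverse>)\<^sup>*" using that by (simp add: conn_rel_def Let_def p)
    then show ?thesis
      by (induction rule: rtrancl_induct) (use edge in auto)
  qed
  have "j < p" if "(i, j) \<in> conn_rel A" for i j
    using that by (simp add: conn_rel_def Let_def p)
  then have "(i, j) \<in> conn_rel A \<longleftrightarrow> j < p \<and> lab j = lab i" if "i < p" for i j
    using that lab[of i j] conn[of i j] by metis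
  then have "conn_rel A `` {i} = {j. j < p \<and> lab j = lab i}" if "i < p" for i
    using that by auto
  then show ?thesis
    unfolding block_structure_eq_components[OF sq] quotient_def label_partition_def p by auto
qed

text \<open>Adding edges inside connected components does not change the components.  This will be used to pass
  from the thresholded correlation matrix to \<open>S\<^sub>B\<close>.\<close>

lemma block_structure_cong:
  assumes "square_mat A" "square_mat A'" "dim_row A = p" "dim_row A' = p"
    and "block_structure A = label_partition p lab"
    and sub: "\<And>i j. i < p \<Longrightarrow> j < p \<Longrightarrow> A $$ (i, j) \<noteq> 0 \<Longrightarrow> A' $$ (i, j) \<noteq> 0"
    and edge: "\<And>i j. i < p \<Longrightarrow> j < p \<Longrightarrow> A' $$ (i, j) \<noteq> 0 \<Longrightarrow> lab i = lab j"
  shows "block_structure A' = label_partition p lab"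
proof (rule block_structure_eq_label_partition)
  fix i j assume ij: "i < p" "j < p" "lab i = lab j"
  have "{k. k < p \<and> lab k = lab i} \<in> label_partition p lab"
    using ij by (auto simp: label_partition_def)
  then have "{k. k < p \<and> lab k = lab i} \<in> {0..<p} // conn_rel A"
    unfolding assms(5)[symmetric] block_structure_eq_components[OF assms(1)] assms(3) .
  moreover have "equiv {0..<p} (conn_rel A)" using equiv_conn_rel[of A] assms(3) by simp
  ultimately have "(i, j) \<in> conn_rel A"
    using in_quotient_imp_in_rel[of "{0..<p}" "conn_rel A" "{k. k < p \<and> lab k = lab i}" i j] ij
    by auto
  moreover have "conn_rel A \<subseteq> conn_rel A'"
    unfolding conn_rel_def Let_def assms(3,4)
    by (intro Int_mono rtrancl_mono Un_mono) (use sub in auto)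
  ultimately show "(i, j) \<in> conn_rel A'" by blast
qed (use assms in auto)

text \<open>An edge heavier than \<open>\<lambda>\<close> cannot cross a cut: all edges from positions before a cut \<open>k\<close> to positions
  from \<open>k\<close> on have weight at most \<open>w k \<le> \<lambda>\<close>.\<close>

lemma prim_order_edge:
  assumes prim: "prim_order p c \<pi> w"
    and sym: "\<And>i j. i < p \<Longrightarrow> j < p \<Longrightarrow> c i j = c j i"
    and ij: "i < p" "j < p" and less: "lam < c (\<pi> i) (\<pi> j)"
  shows "seg_start (cut_at w lam) i = seg_start (cut_at w lam) j"
proof -
  have *: "seg_start (cut_at w lam) i = seg_start (cut_at w lam) j"
    if "i \<le> j" "j < p" "lam < c (\<pi> i) (\<pi> j)" for i j
  proof (cases "seg_start (cut_at w lam) j \<le> i")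
    case True
    then show ?thesis using seg_start_const that by blast
  next
    case False
    let ?k = "seg_start (cut_at w lam) j"
    have "\<not> lam < w ?k" using seg_start_cut[of "cut_at w lam" j] False by auto
    moreover have "c (\<pi> i) (\<pi> j) \<le> w ?k"
      using prim False \<open>j < p\<close> seg_start_le[of "cut_at w lam" j]
      unfolding prim_order_def by (simp add: not_le)
    ultimately show ?thesis using that by linarith
  qed
  have "\<pi> i < p" "\<pi> j < p" using prim ij unfolding prim_order_def bij_betw_def by auto
  then have less': "lam < c (\<pi> j) (\<pi> i)" using less sym[of "\<pi> i" "\<pi> j"] by metis
  show ?thesis
  proof (cases "i \<le> j")
    case True
    show ?thesis by (rule *[OF True ij(2) less])
  next
    case False
    then have "j \<le> i" by simp
    show ?thesis by (rule *[OF \<open>j \<le> i\<close> ij(1) less', symmetric])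
  qed
qed

text \<open>Single linkage clustering through Prim's algorithm.  By the previous lemma the components refine
  the runs.  Conversely each vertex of a run is connected to its first vertex, by induction on the
  position: if there is no cut before \<open>i\<close>, then \<open>\<pi> i\<close> has an edge heavier than \<open>\<lambda>\<close> to an earlier
  vertex, which lies in the same run because edges do not cross cuts.\<close>

lemma threshold_partition_eq:
  assumes S: "S \<in> carrier_mat p p"
    and c: "\<And>i j. i < p \<Longrightarrow> j < p \<Longrightarrow> c i j = \<bar>emp_corr S $$ (i, j)\<bar>"
    and sym: "\<And>i j. i < p \<Longrightarrow> j < p \<Longrightarrow> c i j = c j i"
    and prim: "prim_order p c \<pi> w"
    and lab: "\<And>i. i < p \<Longrightarrow> lab (\<pi> i) = seg_start (cut_at w lam) i"
    and lam: "0 \<le> lam"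
  shows "threshold_partition S lam = label_partition p lab"
proof -
  let ?st = "seg_start (cut_at w lam)"
  let ?A = "corr_threshold (emp_corr S) lam"
  have dims: "square_mat ?A" "dim_row ?A = p"
    using S by (auto simp: corr_threshold_def emp_corr_def)
  have nz: "?A $$ (i, j) \<noteq> 0 \<longleftrightarrow> lam < c i j" if "i < p" "j < p" for i j
    using that S lam c[OF that] by (auto simp: corr_threshold_def emp_corr_def)
  have bij: "\<pi> i < p" if "i < p" for i
    using prim that unfolding prim_order_def bij_betw_def by auto
  have onto: "\<exists>i<p. \<pi> i = x" if "x < p" for x
    using prim bij_betw_lessThan(2) that unfolding prim_order_def by blast
  have equiv: "equiv {0..<p} (conn_rel ?A)" using equiv_conn_rel[of ?A] dims by simp
  have edge: "(x, y) \<in> conn_rel ?A" if "x < p" "y < p" "lam < c x y" for x y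
    using that nz[of x y] dims by (auto simp: conn_rel_def Let_def)
  have root: "(\<pi> (?st i), \<pi> i) \<in> conn_rel ?A" if "i < p" for i
    using that
  proof (induction i rule: less_induct)
    case (less i)
    show ?case
    proof (cases "?st i = i")
      case True
      then show ?thesis using equiv bij[OF less.prems] by (simp add: equiv_def refl_on_def)
    next
      case False
      then have "?st i < i" using seg_start_le[of _ i] le_neq_implies_less by blast
      then have w: "lam < w i" using seg_start_not_cut[of "cut_at w lam" i i] by simp
      then have "w i \<noteq> 0" using lam by simp
      then obtain j where j: "j < i" "w i = c (\<pi> j) (\<pi> i)"
        using prim less.prems unfolding prim_order_def by blast
      then have "?st j = ?st i"
        using prim_order_edge[OF prim sym, of j i lam] w less.prems by auto
      moreover have "(\<pi> (?st j), \<pi> j) \<in> conn_rel ?A" using less j by simp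
      moreover have "(\<pi> j, \<pi> i) \<in> conn_rel ?A"
        using edge[of "\<pi> j" "\<pi> i"] bij j w less.prems by simp
      ultimately show ?thesis using equiv by (metis equiv_def transD)
    qed
  qed
  show ?thesis unfolding threshold_partition_def
  proof (rule block_structure_eq_label_partition[OF dims])
    fix x y assume xy: "x < p" "y < p" "?A $$ (x, y) \<noteq> 0"
    obtain i j where "i < p" "\<pi> i = x" "j < p" "\<pi> j = y" using onto xy by metis
    then show "lab x = lab y"
      using prim_order_edge[OF prim sym, of i j lam] nz[of x y] xy lab by metis
  next
    fix x y assume xy: "x < p" "y < p" "lab x = lab y"
    obtain i j where ij: "i < p" "\<pi> i = x" "j < p" "\<pi> j = y" using onto xy by metis
    then have "?st i = ?st j" using lab xy by metis
    then show "(x, y) \<in> conn_rel ?A"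
      using root[of i] root[of j] ij equiv by (metis equiv_def symE transE)
  qed
qed

text \<open>At position \<open>i\<close> the current run already has \<open>i + 1 - seg_start brk i\<close> elements, so a group is too
  large as soon as some position sees more than \<open>m\<close>.  A scan can decide this.\<close>

lemma card_label_class_le_iff:
  assumes bij: "bij_betw \<pi> {..<p} {..<p}"
    and lab: "\<And>i. i < p \<Longrightarrow> lab (\<pi> i) = seg_start brk i"
  shows "(\<forall>b\<in>label_partition p lab. card b \<le> m) \<longleftrightarrow> (\<forall>i<p. i - seg_start brk i < m)"
proof -
  have \<pi>: "\<pi> i < p" if "i < p" for i using bij that unfolding bij_betw_def by auto
  have onto: "\<exists>i<p. \<pi> i = x" if "x < p" for x
    by (rule bij_betw_lessThan(2)[OF bij that])
  have inj: "inj_on \<pi> {..<p}" using bij by (simp add: bij_betw_def)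
  show ?thesis
  proof
    assume *: "\<forall>b\<in>label_partition p lab. card b \<le> m"
    show "\<forall>i<p. i - seg_start brk i < m"
    proof (intro allI impI)
      fix i assume i: "i < p"
      let ?b = "{x. x < p \<and> lab x = lab (\<pi> i)}"
      have "\<pi> ` {seg_start brk i..i} \<subseteq> ?b"
      proof
        fix x assume "x \<in> \<pi> ` {seg_start brk i..i}"
        then obtain j where j: "x = \<pi> j" "seg_start brk i \<le> j" "j \<le> i" by auto
        then have "lab x = lab (\<pi> i)" using seg_start_const[of brk i j] lab[of j] lab[of i] i by simp
        then show "x \<in> ?b" using j \<pi>[of j] i by simp
      qed
      then have "card (\<pi> ` {seg_start brk i..i}) \<le> card ?b" by (intro card_mono) auto
      moreover have "card (\<pi> ` {seg_start brk i..i}) = Suc i - seg_start brk i"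
        using i by (subst card_image) (auto intro: inj_on_subset[OF inj])
      moreover have "card ?b \<le> m" using * \<pi>[OF i] by (auto simp: label_partition_def)
      ultimately show "i - seg_start brk i < m" using seg_start_le[of brk i] by linarith
    qed
  next
    assume *: "\<forall>i<p. i - seg_start brk i < m"
    show "\<forall>b\<in>label_partition p lab. card b \<le> m"
    proof
      fix b assume "b \<in> label_partition p lab"
      then obtain x where x: "x < p" "b = {y. y < p \<and> lab y = lab x}"
        by (auto simp: label_partition_def)
      then obtain i where i: "i < p" "\<pi> i = x" using onto by blast
      let ?a = "seg_start brk i"
      have "b \<subseteq> \<pi> ` {?a..<?a + m}"
      proof
        fix y assume "y \<in> b"
        then obtain j where "j < p" "\<pi> j = y" "lab y = lab x" using x onto by auto
        then have "j < p" "\<pi> j = y" "seg_start brk j = ?a" using lab i by auto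
        then have "j \<in> {?a..<?a + m}" using *[rule_format, of j] seg_start_le[of brk j] by auto
        then show "y \<in> \<pi> ` {?a..<?a + m}" using \<open>\<pi> j = y\<close> by blast
      qed
      then have "card b \<le> card (\<pi> ` {?a..<?a + m})" by (intro card_mono) auto
      also have "\<dots> \<le> m" using card_image_le[of "{?a..<?a + m}" \<pi>] by simp
      finally show "card b \<le> m" .
    qed
  qed
qed

section \<open>The criterion as a sum over runs\<close>

lemma det_reorder:
  fixes A :: "real mat"
  assumes A: "A \<in> carrier_mat p p" and bij: "bij_betw \<pi> {..<p} {..<p}"
  shows "det (mat p p (\<lambda>(i, j). A $$ (\<pi> i, \<pi> j))) = det A"
proof -
  define q where "q i = (if i < p then \<pi> i else i)" for i
  have "bij_betw q {0..<p} {0..<p}"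
    using bij by (subst bij_betw_cong[where g = \<pi>]) (auto simp: q_def atLeast0LessThan)
  then have q: "q permutes {0..<p}" by (rule bij_imp_permutes) (simp add: q_def)
  have lt: "\<pi> i < p" if "i < p" for i using bij_betw_lessThan(1)[OF bij that] .
  let ?B = "mat p p (\<lambda>(i, j). A $$ (q i, j))"
  let ?C = "mat p p (\<lambda>(i, j). transpose_mat ?B $$ (q i, j))"
  have "mat p p (\<lambda>(i, j). A $$ (\<pi> i, \<pi> j)) = transpose_mat ?C"
    by (rule eq_matI) (auto simp: q_def lt)
  then have "det (mat p p (\<lambda>(i, j). A $$ (\<pi> i, \<pi> j))) = det ?C"
    by (simp add: det_transpose[where n = p])
  also have "\<dots> = signof q * det (transpose_mat ?B)"
    by (rule det_permute_rows[OF _ q]) simp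
  also have "\<dots> = signof q * (signof q * det A)"
    using det_permute_rows[OF A q] by (simp add: det_transpose[where n = p])
  also have "\<dots> = det A"
    by (simp add: mult.assoc[symmetric] of_int_mult[symmetric] del: of_int_mult)
  finally show ?thesis .
qed

text \<open>A kernel vector of the principal submatrix, extended by zeros to \<open>g\<close>, would be a nonzero vector
  with \<open>g \<bullet> S g = 0\<close>.\<close>

lemma principal_det_nonzero:
  assumes pd: "pos_def_mat S" and S: "S \<in> carrier_mat p p"
    and inj: "inj_on f {..<l}" and ran: "\<And>u. u < l \<Longrightarrow> f u < p"
  shows "det (mat l l (\<lambda>(u, v). S $$ (f u, f v))) \<noteq> 0"
proof
  let ?N = "mat l l (\<lambda>(u, v). S $$ (f u, f v))"
  assume "det ?N = 0"
  then obtain z where z: "z \<in> carrier_vec l" "z \<noteq> 0\<^sub>v l" "?N *\<^sub>v z = 0\<^sub>v l"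
    using det_0_iff_vec_prod_zero_field[of ?N l] by auto
  define g where "g = vec p (\<lambda>x. \<Sum>u<l. if f u = x then z $ u else 0)"
  have g: "g \<in> carrier_vec p" by (simp add: g_def)
  have gf: "g $ f u = z $ u" if "u < l" for u
  proof -
    have "g $ f u = (\<Sum>v<l. if f v = f u then z $ v else 0)" using ran[OF that] by (simp add: g_def)
    also have "\<dots> = (\<Sum>v<l. if v = u then z $ v else 0)"
      using inj that by (intro sum.cong) (auto dest: inj_onD)
    also have "\<dots> = z $ u" using that by simp
    finally show ?thesis .
  qed
  have swap: "(\<Sum>x<p. h x * g $ x) = (\<Sum>u<l. h (f u) * z $ u)" for h :: "nat \<Rightarrow> real"
  proof -
    have "(\<Sum>x<p. h x * g $ x) = (\<Sum>x<p. \<Sum>u<l. if f u = x then h x * z $ u else 0)"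
      by (intro sum.cong) (auto simp: g_def sum_distrib_left intro!: sum.cong)
    also have "\<dots> = (\<Sum>u<l. \<Sum>x<p. if f u = x then h x * z $ u else 0)" by (rule sum.swap)
    also have "\<dots> = (\<Sum>u<l. h (f u) * z $ u)" using ran by (intro sum.cong) auto
    finally show ?thesis .
  qed
  have Sg: "(S *\<^sub>v g) $ f u = 0" if "u < l" for u
  proof -
    have "(S *\<^sub>v g) $ f u = (\<Sum>x<p. S $$ (f u, x) * g $ x)"
      using S ran[OF that] g by (auto simp: scalar_prod_def atLeast0LessThan intro!: sum.cong)
    also have "\<dots> = (\<Sum>v<l. S $$ (f u, f v) * z $ v)" by (rule swap)
    also have "\<dots> = (?N *\<^sub>v z) $ u"
      using that z(1) by (auto simp: scalar_prod_def atLeast0LessThan intro!: sum.cong)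
    also have "\<dots> = 0" using z(3) that by simp
    finally show ?thesis .
  qed
  have "g \<bullet> (S *\<^sub>v g) = (\<Sum>x<p. (S *\<^sub>v g) $ x * g $ x)"
    using S g by (auto simp: scalar_prod_def atLeast0LessThan mult.commute intro!: sum.cong)
  also have "\<dots> = 0" unfolding swap using Sg by simp
  finally have "g \<bullet> (S *\<^sub>v g) = 0" .
  moreover have "g \<noteq> 0\<^sub>v p"
  proof
    assume "g = 0\<^sub>v p"
    then have "z = 0\<^sub>v l" using z(1) gf ran by (intro eq_vecI) auto
    then show False using z(2) by simp
  qed
  ultimately show False using pd g S unfolding pos_def_mat_def by fastforce
qed

text \<open>In the order of the list the restricted matrix is block diagonal.  Splitting off the last run relates
  the determinant of the first \<open>i + 1\<close> rows and columns to the one that ends where the current run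
  starts, which is the recursion that the scan follows.\<close>

lemma det_last_block:
  fixes a :: "nat \<Rightarrow> nat \<Rightarrow> real" and brk :: "nat \<Rightarrow> bool"
  defines "M \<equiv> \<lambda>r. mat r r (\<lambda>(i, j). if seg_start brk i = seg_start brk j then a i j else 0)"
  shows "det (M (Suc i)) = det (M (seg_start brk i)) *
    det (mat (Suc i - seg_start brk i) (Suc i - seg_start brk i)
      (\<lambda>(u, v). a (seg_start brk i + u) (seg_start brk i + v)))"
proof -
  let ?s = "seg_start brk i" let ?l = "Suc i - ?s"
  let ?N = "mat ?l ?l (\<lambda>(u, v). a (?s + u) (?s + v))"
  have si: "?s \<le> i" by (rule seg_start_le)
  have right: "seg_start brk j = ?s" if "?s \<le> j" "j < Suc i" for j
    using that by (intro seg_start_const) auto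
  have left: "seg_start brk j < ?s" if "j < ?s" for j
    using seg_start_le[of brk j] that by linarith
  have "M (Suc i) = four_block_mat (M ?s) (0\<^sub>m ?s ?l) (0\<^sub>m ?l ?s) ?N"
  proof (rule eq_matI)
    fix x y
    assume "x < dim_row (four_block_mat (M ?s) (0\<^sub>m ?s ?l) (0\<^sub>m ?l ?s) ?N)"
      and "y < dim_col (four_block_mat (M ?s) (0\<^sub>m ?s ?l) (0\<^sub>m ?l ?s) ?N)"
    then have xy: "x < Suc i" "y < Suc i" using si by (auto simp: M_def)
    show "M (Suc i) $$ (x, y) = four_block_mat (M ?s) (0\<^sub>m ?s ?l) (0\<^sub>m ?l ?s) ?N $$ (x, y)"
    proof (cases "x < ?s"; cases "y < ?s")
      assume *: "x < ?s" "y < ?s"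
      then show ?thesis using xy by (simp add: M_def)
    next
      assume *: "x < ?s" "\<not> y < ?s"
      then have "seg_start brk x \<noteq> seg_start brk y" using left[of x] right[of y] xy by simp
      then show ?thesis using * xy by (simp add: M_def)
    next
      assume *: "\<not> x < ?s" "y < ?s"
      then have "seg_start brk x \<noteq> seg_start brk y" using left[of y] right[of x] xy by simp
      then show ?thesis using * xy by (simp add: M_def)
    next
      assume *: "\<not> x < ?s" "\<not> y < ?s"
      then have "seg_start brk x = seg_start brk y" using right[of x] right[of y] xy by simp
      then show ?thesis using * xy by (simp add: M_def less_diff_conv)
    qed
  qed (use si in \<open>auto simp: M_def\<close>)
  then show ?thesis
    by (simp add: det_four_block_mat_lower_left_zero[where n = ?s and m = ?l] M_def)
qed

text \<open>The number of pairs in a common group is the sum of the squared group sizes; it satisfies the same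
  recursion as the logarithm of the determinant.\<close>

lemma card_segment_pairs:
  "card {(x, y). x < Suc i \<and> y < Suc i \<and> seg_start brk x = seg_start brk y} =
    card {(x, y). x < seg_start brk i \<and> y < seg_start brk i \<and> seg_start brk x = seg_start brk y}
      + (Suc i - seg_start brk i)\<^sup>2"
proof -
  let ?s = "seg_start brk i"
  let ?P = "\<lambda>r. {(x, y). x < r \<and> y < r \<and> seg_start brk x = seg_start brk y}"
  have right: "seg_start brk j = ?s" if "?s \<le> j" "j < Suc i" for j
    using that by (intro seg_start_const) auto
  have left: "seg_start brk j < ?s" if "j < ?s" for j
    using seg_start_le[of brk j] that by linarith
  have eq: "?P (Suc i) = ?P ?s \<union> {?s..<Suc i} \<times> {?s..<Suc i}"
  proof (intro equalityI subsetI)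
    fix z assume "z \<in> ?P (Suc i)"
    then obtain x y where z: "z = (x, y)"
      and xy: "x < Suc i" "y < Suc i" "seg_start brk x = seg_start brk y" by auto
    have "x < ?s \<longleftrightarrow> y < ?s"
      using xy left[of x] left[of y] right[of x] right[of y] by (metis not_le less_irrefl)
    then show "z \<in> ?P ?s \<union> {?s..<Suc i} \<times> {?s..<Suc i}" using z xy by auto
  next
    fix z assume "z \<in> ?P ?s \<union> {?s..<Suc i} \<times> {?s..<Suc i}"
    then obtain x y where z: "z = (x, y)"
      and xy: "x < ?s \<and> y < ?s \<and> seg_start brk x = seg_start brk y \<or>
        ?s \<le> x \<and> x < Suc i \<and> ?s \<le> y \<and> y < Suc i" by auto
    then have "seg_start brk x = seg_start brk y" "x < Suc i" "y < Suc i"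
      using right[of x] right[of y] seg_start_le[of brk i] by auto
    then show "z \<in> ?P (Suc i)" using z by simp
  qed
  have fin: "finite (?P r)" for r by (rule finite_subset[of _ "{..<r} \<times> {..<r}"]) auto
  have "card (?P (Suc i)) = card (?P ?s) + card ({?s..<Suc i} \<times> {?s..<Suc i})"
    unfolding eq using fin by (intro card_Un_disjoint) auto
  then show ?thesis by (simp add: power2_eq_square)
qed

text \<open>Entry \<open>r\<close> of the array \<open>V\<close> filled by the scan accounts for the first \<open>r\<close> positions.  The last
  run is not known to be complete when its positions are visited, so every entry is computed from the
  one at the start of the current run and not from its predecessor.\<close>

lemma segment_sum_eq:
  fixes a :: "nat \<Rightarrow> nat \<Rightarrow> real"
  assumes V0: "V 0 = 0"
    and V: "\<And>i. i < p \<Longrightarrow> V (Suc i) = V (seg_start brk i) +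
      ln (det (mat (Suc i - seg_start brk i) (Suc i - seg_start brk i)
        (\<lambda>(u, v). a (seg_start brk i + u) (seg_start brk i + v)))) / q +
      \<kappa> * (real (Suc i - seg_start brk i))\<^sup>2"
    and nz: "\<And>i. i < p \<Longrightarrow> det (mat (Suc i - seg_start brk i) (Suc i - seg_start brk i)
        (\<lambda>(u, v). a (seg_start brk i + u) (seg_start brk i + v))) \<noteq> 0"
    and r: "r \<le> p"
  shows "det (mat r r (\<lambda>(i, j). if seg_start brk i = seg_start brk j then a i j else 0)) \<noteq> 0 \<and>
    V r = ln (det (mat r r (\<lambda>(i, j). if seg_start brk i = seg_start brk j then a i j else 0))) / q +
      \<kappa> * real (card {(i, j). i < r \<and> j < r \<and> seg_start brk i = seg_start brk j})"
  using r
proof (induction r rule: less_induct)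
  case (less r)
  show ?case
  proof (cases r)
    case 0
    then show ?thesis using V0 by simp
  next
    case (Suc i)
    then have i: "i < p" "seg_start brk i < r" "seg_start brk i \<le> p"
      using less.prems seg_start_le[of brk i] by auto
    show ?thesis
      using less.IH[OF i(2,3)] V[OF i(1)] nz[OF i(1)]
      unfolding Suc det_last_block[of i brk a] card_segment_pairs[of i brk]
      by (simp add: ln_mult add_divide_distrib algebra_simps)
  qed
qed

text \<open>If \<open>K\<close> is the inverse of \<open>A = S\<^sub>B\<close>, then \<open>K\<^sub>B\<close> is a left inverse as well, because the entries of
  \<open>K A\<close> within a group only involve entries of \<open>K\<close> within that group.  So \<open>K = K\<^sub>B\<close>, and the trace of
  \<open>K S\<close> only meets entries of \<open>S\<close> within the groups: it equals the trace of \<open>K A = 1\<close>.\<close>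

lemma trace_block_inverse:
  assumes S: "S \<in> carrier_mat p p"
    and det: "det (mat p p (\<lambda>(x, y). if lab x = lab y then S $$ (x, y) else 0)) \<noteq> 0"
  shows "mat_trace (the (mat_inverse
    (mat p p (\<lambda>(x, y). if lab x = lab y then S $$ (x, y) else 0))) * S) = real p"
proof -
  define A where "A = mat p p (\<lambda>(x, y). if lab x = lab y then S $$ (x, y) else 0)"
  have A: "A \<in> carrier_mat p p" by (simp add: A_def)
  have "A \<in> Units (ring_mat TYPE(real) p ())"
    by (rule det_non_zero_imp_unit[OF A]) (use det A_def in simp)
  then have "mat_inverse A \<noteq> None" using mat_inverse(1)[OF A, where b = "()"] by blast
  then obtain K where K: "mat_inverse A = Some K" by blast
  then have inv: "A * K = 1\<^sub>m p" "K * A = 1\<^sub>m p" and Kc: "K \<in> carrier_mat p p"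
    using mat_inverse(2)[OF A K] by auto
  define L where "L = mat p p (\<lambda>(x, y). if lab x = lab y then K $$ (x, y) else 0)"
  have L: "L \<in> carrier_mat p p" by (simp add: L_def)
  have "L * A = 1\<^sub>m p"
  proof (rule eq_matI)
    fix x y assume "x < dim_row (1\<^sub>m p)" "y < dim_col (1\<^sub>m p)"
    then have xy: "x < p" "y < p" by auto
    have "(L * A) $$ (x, y) = (\<Sum>k<p. L $$ (x, k) * A $$ (k, y))"
      using xy L A by (auto simp: scalar_prod_def atLeast0LessThan intro!: sum.cong)
    also have "\<dots> = (if lab x = lab y then (\<Sum>k<p. K $$ (x, k) * A $$ (k, y)) else 0)"
    proof (cases "lab x = lab y")
      case True
      then show ?thesis using xy by (auto simp: L_def A_def intro!: sum.cong)
    next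
      case False
      then show ?thesis using xy by (auto simp: L_def A_def intro!: sum.neutral)
    qed
    also have "(\<Sum>k<p. K $$ (x, k) * A $$ (k, y)) = (K * A) $$ (x, y)"
      using xy Kc A by (auto simp: scalar_prod_def atLeast0LessThan intro!: sum.cong)
    finally show "(L * A) $$ (x, y) = 1\<^sub>m p $$ (x, y)" using inv xy by auto
  qed (use L A in auto)
  moreover have "L * A * K = L * (A * K)" by (rule assoc_mult_mat[OF L A Kc])
  ultimately have "L = K" using inv(1) L Kc by simp
  have "mat_trace (K * S) = (\<Sum>x<p. \<Sum>k<p. K $$ (x, k) * S $$ (k, x))"
    using Kc S by (auto simp: mat_trace_def scalar_prod_def atLeast0LessThan intro!: sum.cong)
  also have "\<dots> = (\<Sum>x<p. \<Sum>k<p. K $$ (x, k) * A $$ (k, x))"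
  proof (intro sum.cong refl)
    fix x k assume xk: "x \<in> {..<p}" "k \<in> {..<p}"
    show "K $$ (x, k) * S $$ (k, x) = K $$ (x, k) * A $$ (k, x)"
    proof (cases "lab x = lab k")
      case True
      then show ?thesis using xk by (simp add: A_def)
    next
      case False
      then have "L $$ (x, k) = 0" using xk by (simp add: L_def)
      then show ?thesis using \<open>L = K\<close> by simp
    qed
  qed
  also have "\<dots> = (\<Sum>x<p. (K * A) $$ (x, x))"
    using Kc A by (auto simp: scalar_prod_def atLeast0LessThan intro!: sum.cong)
  also have "\<dots> = real p" using inv by simp
  finally show ?thesis using K unfolding A_def by simp
qed

lemma sum_card_label_partition:
  assumes bij: "bij_betw \<pi> {..<p} {..<p}"
    and lab: "\<And>i. i < p \<Longrightarrow> lab (\<pi> i) = st i"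
  shows "(\<Sum>b\<in>label_partition p lab. (real (card b))\<^sup>2) =
    real (card {(i, j). i < p \<and> j < p \<and> st i = st j})"
proof -
  let ?B = "label_partition p lab"
  let ?Q = "{(x, y). x < p \<and> y < p \<and> lab x = lab y}"
  let ?P = "{(i, j). i < p \<and> j < p \<and> st i = st j}"
  have fin: "finite b" if "b \<in> ?B" for b using that by (auto simp: label_partition_def)
  have "?Q = (\<Union>b\<in>?B. b \<times> b)" by (auto simp: label_partition_def)
  also have "card \<dots> = (\<Sum>b\<in>?B. card (b \<times> b))"
    by (rule card_UN_disjoint) (auto simp: label_partition_def)
  finally have Q: "card ?Q = (\<Sum>b\<in>?B. (card b)\<^sup>2)" by (simp add: card_cartesian_product power2_eq_square)
  have "?Q = map_prod \<pi> \<pi> ` ?P"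
  proof (intro equalityI subsetI)
    fix z assume "z \<in> ?Q"
    then obtain x y where z: "z = (x, y)" "x < p" "y < p" "lab x = lab y" by auto
    obtain i j where "i < p" "\<pi> i = x" "j < p" "\<pi> j = y"
      using bij_betw_lessThan(2)[OF bij] z by metis
    then have "z = map_prod \<pi> \<pi> (i, j)" "(i, j) \<in> ?P" using z lab by auto
    then show "z \<in> map_prod \<pi> \<pi> ` ?P" by blast
  next
    fix z assume "z \<in> map_prod \<pi> \<pi> ` ?P"
    then show "z \<in> ?Q" using lab bij_betw_lessThan(1)[OF bij] by auto
  qed
  moreover have "inj_on (map_prod \<pi> \<pi>) ?P"
    using bij unfolding bij_betw_def inj_on_def by auto
  ultimately have "card ?Q = card ?P" by (simp add: card_image)
  with Q show ?thesis by (simp flip: of_nat_power of_nat_sum)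
qed

text \<open>The contribution of one group, in positions \<open>a, \<dots>, a + l - 1\<close>, to the criterion.\<close>

definition seg_term :: "nat \<Rightarrow> real \<Rightarrow> real mat \<Rightarrow> (nat \<Rightarrow> nat) \<Rightarrow> nat \<Rightarrow> nat \<Rightarrow> real" where
  "seg_term p \<kappa> S \<pi> a l =
     ln (det (mat l l (\<lambda>(u, v). S $$ (\<pi> (a + u), \<pi> (a + v))))) / real p + \<kappa> * (real l)\<^sup>2"

text \<open>The summand \<open>1\<close> is the trace term \<open>p / p\<close>; it is the same for all partitions.\<close>

lemma crit_label_partition:
  fixes S :: "real mat"
  assumes S: "S \<in> carrier_mat p p" and pd: "pos_def_mat S" and p: "1 \<le> p"
    and bij: "bij_betw \<pi> {..<p} {..<p}"
    and lab: "\<And>i. i < p \<Longrightarrow> lab (\<pi> i) = seg_start brk i"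
    and blocks: "block_structure (block_restrict S (label_partition p lab)) = label_partition p lab"
    and V0: "V 0 = 0"
    and V: "\<And>i. i < p \<Longrightarrow> V (Suc i) = V (seg_start brk i) +
      seg_term p \<kappa> S \<pi> (seg_start brk i) (Suc i - seg_start brk i)"
  shows "crit \<kappa> S (label_partition p lab) = V p + 1"
proof -
  let ?B = "label_partition p lab"
  let ?A = "mat p p (\<lambda>(x, y). if lab x = lab y then S $$ (x, y) else 0)"
  let ?M = "mat p p (\<lambda>(i, j). if seg_start brk i = seg_start brk j then S $$ (\<pi> i, \<pi> j) else 0)"
  have lt: "\<pi> i < p" if "i < p" for i using bij_betw_lessThan(1)[OF bij that] .
  have A: "block_restrict S ?B = ?A"
    using S unfolding block_restrict_def label_partition_def by (intro eq_matI) auto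
  have "mat p p (\<lambda>(i, j). ?A $$ (\<pi> i, \<pi> j)) = ?M"
    using lt lab by (intro eq_matI) auto
  then have det: "det ?A = det ?M" using det_reorder[of ?A p \<pi>] bij by simp
  have "det (mat (Suc i - seg_start brk i) (Suc i - seg_start brk i)
      (\<lambda>(u, v). S $$ (\<pi> (seg_start brk i + u), \<pi> (seg_start brk i + v)))) \<noteq> 0" if "i < p" for i
  proof (rule principal_det_nonzero[OF pd S])
    have sub: "seg_start brk i + u < p" if "u < Suc i - seg_start brk i" for u
      using that \<open>i < p\<close> by linarith
    have inj: "inj_on \<pi> {..<p}" using bij by (simp add: bij_betw_def)
    show "inj_on (\<lambda>u. \<pi> (seg_start brk i + u)) {..<Suc i - seg_start brk i}"
    proof (rule inj_onI)
      fix u v assume uv: "u \<in> {..<Suc i - seg_start brk i}" "v \<in> {..<Suc i - seg_start brk i}"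
        and eq: "\<pi> (seg_start brk i + u) = \<pi> (seg_start brk i + v)"
      have "seg_start brk i + u = seg_start brk i + v"
        by (rule inj_onD[OF inj eq]) (use uv sub in simp_all)
      then show "u = v" by simp
    qed
    show "\<pi> (seg_start brk i + u) < p" if "u < Suc i - seg_start brk i" for u
      using lt sub that by blast
  qed
  then have seg: "det ?M \<noteq> 0 \<and> V p = ln (det ?M) / real p + \<kappa> * real (card {(i, j). i < p \<and> j < p \<and>
      seg_start brk i = seg_start brk j})"
    using segment_sum_eq[of V p brk "\<lambda>i j. S $$ (\<pi> i, \<pi> j)" "real p" \<kappa> p] V0 V
    unfolding seg_term_def add.assoc by blast
  have "mat_trace (the (mat_inverse ?A) * S) = real p"
    using seg det by (intro trace_block_inverse[OF S]) simp
  then have "neg_loglik S ?A = (ln (det ?M) + real p) / real p"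
    using S by (simp add: neg_loglik_def det)
  moreover have "pen ?A = real (card {(i, j). i < p \<and> j < p \<and> seg_start brk i = seg_start brk j})"
    using blocks sum_card_label_partition[of \<pi> p lab "seg_start brk"] bij lab
    by (simp add: pen_def A)
  ultimately show ?thesis
    using seg p by (simp add: crit_def crit_mat_def A add_divide_distrib)
qed

section \<open>Prim's algorithm as a program\<close>

text \<open>Registers of the programs below.  Indices: \<open>0\<close> is \<open>p\<close>, \<open>1\<close> the outer and \<open>2\<close> the inner loop
  counter, \<open>3\<close> the vertex chosen by Prim's algorithm, \<open>4\<close> the start of the current run, \<open>5\<close> is
  nonzero when the current level is not admissible, and \<open>6\<close> is the best level.  Reals: \<open>0\<close> is
  \<open>\<kappa>\<close>, \<open>1\<close> the logarithm of a determinant, \<open>2\<close> the best value.  Index arrays: \<open>0\<close> holds the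
  output labels, \<open>1\<close> the order \<open>\<pi>\<close>.  Real arrays: \<open>0\<close> is \<open>S\<close>, \<open>1\<close> holds the keys of Prim's
  algorithm, \<open>2\<close> the attachment weights \<open>w\<close>, and \<open>3\<close> the partial sums \<open>V\<close>.\<close>

lemma holds_input_upd [simp]:
  "f 0 = ivar \<sigma> 0 \<Longrightarrow> holds_input p \<kappa> S (\<sigma>\<lparr>ivar := f\<rparr>) = holds_input p \<kappa> S \<sigma>"
  "g 0 = rvar \<sigma> 0 \<Longrightarrow> holds_input p \<kappa> S (\<sigma>\<lparr>rvar := g\<rparr>) = holds_input p \<kappa> S \<sigma>"
  "holds_input p \<kappa> S (iarr_upd a i j v \<sigma>) = holds_input p \<kappa> S \<sigma>"
  "a \<noteq> 0 \<Longrightarrow> holds_input p \<kappa> S (rarr_upd a i j y \<sigma>) = holds_input p \<kappa> S \<sigma>"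
  by (simp_all add: holds_input_def)

lemma rarr_upd_other [simp]: "a' \<noteq> a \<Longrightarrow> rarr (rarr_upd a i j v \<sigma>) a' = rarr \<sigma> a'"
  by (simp add: rarr_upd_def)

text \<open>The machine has no absolute value; \<open>\<surd>(c c)\<close> replaces it.\<close>

definition corr_exp :: "iexp \<Rightarrow> iexp \<Rightarrow> rexp" where
  "corr_exp i j = (let c = RDiv (RGet 0 i j) (RSqrt (RMul (RGet 0 i i) (RGet 0 j j)))
     in RSqrt (RMul c c))"

lemma rval_corr_exp:
  assumes "holds_input p \<kappa> S \<sigma>" "S \<in> carrier_mat p p" "ival i \<sigma> < p" "ival j \<sigma> < p"
  shows "rval (corr_exp i j) \<sigma> = \<bar>emp_corr S $$ (ival i \<sigma>, ival j \<sigma>)\<bar>"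
proof -
  have "rval (RDiv (RGet 0 i j) (RSqrt (RMul (RGet 0 i i) (RGet 0 j j)))) \<sigma> =
      emp_corr S $$ (ival i \<sigma>, ival j \<sigma>)"
    using assms by (simp add: holds_input_def emp_corr_def)
  then show ?thesis
    by (simp only: corr_exp_def Let_def rval.simps real_sqrt_abs2)
qed

abbreviation key_exp :: "iexp \<Rightarrow> rexp" where "key_exp i \<equiv> RGet 1 i (ICon 0)"

definition select_max :: com where
  "select_max = Seq (ISet 3 (ICon 0)) (For 2 (IVar 0)
     (Cond (RLess (key_exp (IVar 3)) (key_exp (IVar 2))) (ISet 3 (IVar 2)) Skip))"

definition update_keys :: com where
  "update_keys = For 2 (IVar 0)
     (Cond (BAnd (BNot (RLess (key_exp (IVar 2)) (ROfIndex (ICon 0))))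
         (RLess (key_exp (IVar 2)) (corr_exp (IVar 3) (IVar 2))))
       (RPut 1 (IVar 2) (ICon 0) (corr_exp (IVar 3) (IVar 2))) Skip)"

definition prim_step :: com where
  "prim_step = Seq select_max (Seq (IPut 1 (IVar 1) (ICon 0) (IVar 3))
     (Seq (RPut 2 (IVar 1) (ICon 0) (key_exp (IVar 3)))
     (Seq (RPut 1 (IVar 3) (ICon 0) (RSub (ROfIndex (ICon 0)) (ROfIndex (ICon 1)))) update_keys)))"

definition prim_prog :: com where
  "prim_prog = Seq (For 2 (IVar 0) (RPut 1 (IVar 2) (ICon 0) (ROfIndex (ICon 0))))
     (For 1 (IVar 0) prim_step)"

text \<open>The state after \<open>r\<close> rounds.  The key of a free vertex is the weight of its heaviest edge to
  the vertices taken, and taken vertices are marked by the key \<open>-1\<close>, which no maximum search prefers to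
  a key of a free vertex.  The last two conjuncts collect what \<open>prim_order\<close> demands of the vertices
  already placed.\<close>

definition prim_inv ::
  "nat \<Rightarrow> (nat \<Rightarrow> nat \<Rightarrow> real) \<Rightarrow> nat \<Rightarrow> (nat \<Rightarrow> nat) \<Rightarrow> (nat \<Rightarrow> real) \<Rightarrow> (nat \<Rightarrow> real) \<Rightarrow> bool" where
  "prim_inv p c r \<pi> w key \<longleftrightarrow>
     inj_on \<pi> {..<r} \<and> \<pi> ` {..<r} \<subseteq> {..<p} \<and> (\<forall>j\<in>\<pi> ` {..<r}. key j = -1) \<and>
     (\<forall>j<p. j \<notin> \<pi> ` {..<r} \<longrightarrow> 0 \<le> key j \<and> (\<forall>i<r. c (\<pi> i) j \<le> key j) \<and>
        (key j = 0 \<or> (\<exists>i<r. key j = c (\<pi> i) j))) \<and>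
     (\<forall>i<r. w i = 0 \<or> (\<exists>k<i. w i = c (\<pi> k) (\<pi> i))) \<and>
     (\<forall>i<r. \<forall>k<i. \<forall>j<p. j \<notin> \<pi> ` {..<i} \<longrightarrow> c (\<pi> k) j \<le> w i)"

lemma prim_inv_step:
  assumes inv: "prim_inv p c r \<pi> w key" and r: "r < p" and b: "b < p"
    and max: "\<And>j. j < p \<Longrightarrow> key j \<le> key b"
    and key': "\<And>j. j < p \<Longrightarrow> key' j =
      (if j = b then -1 else if 0 \<le> key j \<and> key j < c b j then c b j else key j)"
    and \<pi>': "\<And>i. \<pi>' i = (if i = r then b else \<pi> i)"
    and w': "\<And>i. w' i = (if i = r then key b else w i)"
  shows "prim_inv p c (Suc r) \<pi>' w' key'"
proof -
  have inj: "inj_on \<pi> {..<r}" and ran: "\<pi> ` {..<r} \<subseteq> {..<p}"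
    and used: "\<And>j. j \<in> \<pi> ` {..<r} \<Longrightarrow> key j = -1"
    and free: "\<And>j. j < p \<Longrightarrow> j \<notin> \<pi> ` {..<r} \<Longrightarrow> 0 \<le> key j \<and> (\<forall>i<r. c (\<pi> i) j \<le> key j) \<and>
        (key j = 0 \<or> (\<exists>i<r. key j = c (\<pi> i) j))"
    and attach: "\<And>i. i < r \<Longrightarrow> w i = 0 \<or> (\<exists>k<i. w i = c (\<pi> k) (\<pi> i))"
    and dom: "\<And>i k j. i < r \<Longrightarrow> k < i \<Longrightarrow> j < p \<Longrightarrow> j \<notin> \<pi> ` {..<i} \<Longrightarrow> c (\<pi> k) j \<le> w i"
    using inv unfolding prim_inv_def by blast+
  \<comment> \<open>Some vertex is still free, so the maximal key is not negative and belongs to a free vertex.\<close>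
  have "card (\<pi> ` {..<r}) < card {..<p}"
    using card_image_le[of "{..<r}" \<pi>] r by simp
  then obtain j where "j < p" "j \<notin> \<pi> ` {..<r}"
    by (metis card_mono finite_imageI finite_lessThan lessThan_iff not_le subsetI)
  then have "0 \<le> key b" using free max by force
  then have b_free: "b \<notin> \<pi> ` {..<r}" using used by force
  have old: "\<pi>' i = \<pi> i" "w' i = w i" if "i < r" for i using that by (simp_all add: \<pi>' w')
  have new: "\<pi>' r = b" "w' r = key b" by (simp_all add: \<pi>' w')
  have im: "\<pi>' ` {..<i} = \<pi> ` {..<i}" if "i \<le> r" for i
    using that by (intro image_cong) (auto simp: \<pi>')
  have imS: "\<pi>' ` {..<Suc r} = insert b (\<pi> ` {..<r})"
    using im[of r] by (simp add: lessThan_Suc new)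
  have "inj_on \<pi>' {..<r}" using inj inj_on_cong[of "{..<r}" \<pi>' \<pi>] old by simp
  then have "inj_on \<pi>' {..<Suc r}"
    using b_free im[of r] by (simp add: lessThan_Suc new)
  moreover have "\<pi>' ` {..<Suc r} \<subseteq> {..<p}" using imS ran b by simp
  moreover have "\<forall>j\<in>\<pi>' ` {..<Suc r}. key' j = -1"
  proof
    fix j assume j: "j \<in> \<pi>' ` {..<Suc r}"
    show "key' j = -1"
    proof (cases "j = b")
      case True
      then show ?thesis using key' b by simp
    next
      case False
      then have "j \<in> \<pi> ` {..<r}" using j imS by simp
      then have "key j = -1" "j < p" using used ran by auto
      then show ?thesis using key'[of j] by simp
    qed
  qed
  moreover have "\<forall>j<p. j \<notin> \<pi>' ` {..<Suc r} \<longrightarrow> 0 \<le> key' j \<and> (\<forall>i<Suc r. c (\<pi>' i) j \<le> key' j) \<and>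
        (key' j = 0 \<or> (\<exists>i<Suc r. key' j = c (\<pi>' i) j))"
  proof (intro allI impI)
    fix j assume j: "j < p" "j \<notin> \<pi>' ` {..<Suc r}"
    then have jb: "j \<noteq> b" and fr: "0 \<le> key j" "\<And>i. i < r \<Longrightarrow> c (\<pi> i) j \<le> key j"
        "key j = 0 \<or> (\<exists>i<r. key j = c (\<pi> i) j)"
      using free[of j] imS by auto
    have k: "key' j = (if key j < c b j then c b j else key j)" using key'[OF j(1)] jb fr(1) by simp
    have "c (\<pi>' i) j \<le> key' j" if "i < Suc r" for i
    proof (cases "i = r")
      case True
      then show ?thesis using k new by simp
    next
      case False
      then show ?thesis using k fr(2)[of i] old(1)[of i] that by auto
    qed
    moreover have "key' j = 0 \<or> (\<exists>i<Suc r. key' j = c (\<pi>' i) j)"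
    proof (cases "key j < c b j")
      case True
      then show ?thesis using k new by auto
    next
      case False
      then show ?thesis using k fr(3) old(1) by (metis less_Suc_eq)
    qed
    ultimately show "0 \<le> key' j \<and> (\<forall>i<Suc r. c (\<pi>' i) j \<le> key' j) \<and>
        (key' j = 0 \<or> (\<exists>i<Suc r. key' j = c (\<pi>' i) j))" using k fr(1) by auto
  qed
  moreover have "\<forall>i<Suc r. w' i = 0 \<or> (\<exists>k<i. w' i = c (\<pi>' k) (\<pi>' i))"
  proof (intro allI impI)
    fix i assume i: "i < Suc r"
    show "w' i = 0 \<or> (\<exists>k<i. w' i = c (\<pi>' k) (\<pi>' i))"
    proof (cases "i = r")
      case True
      then show ?thesis using free[OF b b_free] new old(1) by metis
    next
      case False
      then have "i < r" using i by simp
      then show ?thesis using attach[of i] old by (metis less_trans)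
    qed
  qed
  moreover have "\<forall>i<Suc r. \<forall>k<i. \<forall>j<p. j \<notin> \<pi>' ` {..<i} \<longrightarrow> c (\<pi>' k) j \<le> w' i"
  proof (intro allI impI)
    fix i k j assume *: "i < Suc r" "k < i" "j < p" "j \<notin> \<pi>' ` {..<i}"
    then have "j \<notin> \<pi> ` {..<i}" and "\<pi>' k = \<pi> k" using im[of i] old(1)[of k] by simp_all
    show "c (\<pi>' k) j \<le> w' i"
    proof (cases "i = r")
      case True
      then have "c (\<pi> k) j \<le> key j" using free[OF *(3)] *(2) \<open>j \<notin> \<pi> ` {..<i}\<close> by blast
      also have "\<dots> \<le> key b" by (rule max[OF *(3)])
      finally show ?thesis using True new(2) \<open>\<pi>' k = \<pi> k\<close> by simp
    next
      case False
      then have "i < r" using *(1) by simp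
      then show ?thesis
        using dom[OF \<open>i < r\<close> *(2,3)] old(2)[OF \<open>i < r\<close>] \<open>\<pi>' k = \<pi> k\<close> \<open>j \<notin> \<pi> ` {..<i}\<close> by simp
    qed
  qed
  ultimately show ?thesis unfolding prim_inv_def by blast
qed

lemma prim_inv_final:
  assumes inv: "prim_inv p c p \<pi> w key"
  shows "prim_order p c \<pi> w"
proof -
  have inj: "inj_on \<pi> {..<p}" and ran: "\<pi> ` {..<p} \<subseteq> {..<p}"
    and attach: "\<forall>i<p. w i = 0 \<or> (\<exists>k<i. w i = c (\<pi> k) (\<pi> i))"
    and dom: "\<forall>i<p. \<forall>k<i. \<forall>j<p. j \<notin> \<pi> ` {..<i} \<longrightarrow> c (\<pi> k) j \<le> w i"
    using inv by (simp_all add: prim_inv_def)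
  have "\<pi> ` {..<p} = {..<p}"
    by (rule card_subset_eq[OF finite_lessThan ran]) (simp add: card_image[OF inj])
  with inj have "bij_betw \<pi> {..<p} {..<p}" by (simp add: bij_betw_def)
  moreover have "c (\<pi> i) (\<pi> j) \<le> w r" if "r < p" "i < r" "r \<le> j" "j < p" for r i j
  proof -
    have "\<pi> j \<notin> \<pi> ` {..<r}" 
    proof
      assume "\<pi> j \<in> \<pi> ` {..<r}"
      then obtain k where k: "k < r" "\<pi> j = \<pi> k" by auto
      have "j = k" by (rule inj_onD[OF inj k(2)]) (use that k in simp_all)
      then show False using k that by simp
    qed
    moreover have "\<pi> j < p" using ran that by auto
    ultimately show ?thesis using dom that by simp
  qed
  ultimately show ?thesis using attach unfolding prim_order_def by simp
qed

lemma runs_select_max: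
  assumes \<sigma>: "ivar \<sigma> 0 = p" "0 < p" and n: "p \<le> n"
    and Q: "\<And>\<tau>. ivar \<tau> 0 = p \<Longrightarrow> ivar \<tau> 1 = ivar \<sigma> 1 \<Longrightarrow> rvar \<tau> = rvar \<sigma> \<Longrightarrow> iarr \<tau> = iarr \<sigma> \<Longrightarrow>
      rarr \<tau> = rarr \<sigma> \<Longrightarrow> ivar \<tau> 3 < p \<Longrightarrow>
      (\<And>j. j < p \<Longrightarrow> rarr \<sigma> 1 j 0 \<le> rarr \<sigma> 1 (ivar \<tau> 3) 0) \<Longrightarrow> Q \<tau>"
  shows "runs n select_max \<sigma> Q"
  unfolding select_max_def
proof (intro runs_Seq runs_ISet)
  let ?I = "\<lambda>k (\<tau> :: store). ivar \<tau> 0 = p \<and> ivar \<tau> 1 = ivar \<sigma> 1 \<and> rvar \<tau> = rvar \<sigma> \<and> iarr \<tau> = iarr \<sigma> \<and>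
    rarr \<tau> = rarr \<sigma> \<and> ivar \<tau> 3 < p \<and> (\<forall>j<k. rarr \<sigma> 1 j 0 \<le> rarr \<sigma> 1 (ivar \<tau> 3) 0)"
  show "runs n (For 2 (IVar 0) (Cond (RLess (key_exp (IVar 3)) (key_exp (IVar 2)))
      (ISet 3 (IVar 2)) Skip)) (\<sigma>\<lparr>ivar := (ivar \<sigma>)(3 := ival (ICon 0) \<sigma>)\<rparr>) Q"
  proof (rule runs_For[where I = ?I and N = p])
    fix k \<tau> assume *: "k < p" "?I k \<tau>" "ivar \<tau> 2 = k"
    show "runs n (Cond (RLess (key_exp (IVar 3)) (key_exp (IVar 2))) (ISet 3 (IVar 2)) Skip) \<tau>
        (\<lambda>\<tau>'. ivar \<tau>' 2 = k \<and> ?I (Suc k) (\<tau>'\<lparr>ivar := (ivar \<tau>')(2 := Suc k)\<rparr>))"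
      using * by (intro runs_Cond runs_ISet runs_Skip) (force simp: less_Suc_eq)+
  qed (use \<sigma> n Q in auto)
qed

lemma runs_update_keys:
  assumes \<sigma>: "holds_input p \<kappa> S \<sigma>" and S: "S \<in> carrier_mat p p" and n: "p \<le> n"
    and b: "ivar \<sigma> 3 = b" "b < p"
    and Q: "\<And>\<tau>. holds_input p \<kappa> S \<tau> \<Longrightarrow> ivar \<tau> 1 = ivar \<sigma> 1 \<Longrightarrow> iarr \<tau> = iarr \<sigma> \<Longrightarrow>
      rarr \<tau> 2 = rarr \<sigma> 2 \<Longrightarrow>
      (\<And>j. j < p \<Longrightarrow> rarr \<tau> 1 j 0 = (if 0 \<le> rarr \<sigma> 1 j 0 \<and> rarr \<sigma> 1 j 0 < \<bar>emp_corr S $$ (b, j)\<bar>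
         then \<bar>emp_corr S $$ (b, j)\<bar> else rarr \<sigma> 1 j 0)) \<Longrightarrow> Q \<tau>"
  shows "runs n update_keys \<sigma> Q"
  unfolding update_keys_def
proof -
  let ?new = "\<lambda>j. if 0 \<le> rarr \<sigma> 1 j 0 \<and> rarr \<sigma> 1 j 0 < \<bar>emp_corr S $$ (b, j)\<bar>
         then \<bar>emp_corr S $$ (b, j)\<bar> else rarr \<sigma> 1 j 0"
  let ?I = "\<lambda>k (\<tau> :: store). holds_input p \<kappa> S \<tau> \<and> ivar \<tau> 1 = ivar \<sigma> 1 \<and> ivar \<tau> 3 = b \<and> iarr \<tau> = iarr \<sigma> \<and>
      rarr \<tau> 2 = rarr \<sigma> 2 \<and> (\<forall>j. rarr \<tau> 1 j 0 = (if j < k then ?new j else rarr \<sigma> 1 j 0))"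
  let ?c = "Cond (BAnd (BNot (RLess (key_exp (IVar 2)) (ROfIndex (ICon 0))))
         (RLess (key_exp (IVar 2)) (corr_exp (IVar 3) (IVar 2))))
       (RPut 1 (IVar 2) (ICon 0) (corr_exp (IVar 3) (IVar 2))) Skip"
  show "runs n (For 2 (IVar 0) ?c) \<sigma> Q"
  proof (rule runs_For[where I = ?I and N = p])
    fix k \<tau> assume *: "k < p" "?I k \<tau>" "ivar \<tau> 2 = k"
    then have corr: "rval (corr_exp (IVar 3) (IVar 2)) \<tau> = \<bar>emp_corr S $$ (b, k)\<bar>"
      using rval_corr_exp[of p \<kappa> S \<tau> "IVar 3" "IVar 2"] S b by simp
    have key: "rarr \<tau> 1 k 0 = rarr \<sigma> 1 k 0" using * by simp
    show "runs n ?c \<tau> (\<lambda>\<tau>'. ivar \<tau>' 2 = k \<and> ?I (Suc k) (\<tau>'\<lparr>ivar := (ivar \<tau>')(2 := Suc k)\<rparr>))"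
    proof (intro runs_Cond runs_RPut runs_Skip)
      assume "bval (BAnd (BNot (RLess (key_exp (IVar 2)) (ROfIndex (ICon 0))))
         (RLess (key_exp (IVar 2)) (corr_exp (IVar 3) (IVar 2)))) \<tau>"
      then have "?new k = \<bar>emp_corr S $$ (b, k)\<bar>" using *(3) corr key by simp
      then show "ivar (rarr_upd 1 (ival (IVar 2) \<tau>) (ival (ICon 0) \<tau>)
           (rval (corr_exp (IVar 3) (IVar 2)) \<tau>) \<tau>) 2 = k \<and>
         ?I (Suc k) ((rarr_upd 1 (ival (IVar 2) \<tau>) (ival (ICon 0) \<tau>)
           (rval (corr_exp (IVar 3) (IVar 2)) \<tau>) \<tau>)\<lparr>ivar := (ivar (rarr_upd 1 (ival (IVar 2) \<tau>)
           (ival (ICon 0) \<tau>) (rval (corr_exp (IVar 3) (IVar 2)) \<tau>) \<tau>))(2 := Suc k)\<rparr>)"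
        using * corr by (auto simp: less_Suc_eq)
    next
      assume "\<not> bval (BAnd (BNot (RLess (key_exp (IVar 2)) (ROfIndex (ICon 0))))
         (RLess (key_exp (IVar 2)) (corr_exp (IVar 3) (IVar 2)))) \<tau>"
      then have "?new k = rarr \<sigma> 1 k 0" using *(3) corr key by auto
      then show "ivar \<tau> 2 = k \<and> ?I (Suc k) (\<tau>\<lparr>ivar := (ivar \<tau>)(2 := Suc k)\<rparr>)"
        using * by (auto simp: less_Suc_eq)
    qed
  next
    fix k \<tau> assume "?I k \<tau>"
    then show "ival (IVar 0) \<tau> = p" by (simp add: holds_input_def)
  qed (use \<sigma> n b Q in auto)
qed

lemma runs_prim_prog:
  assumes \<sigma>: "holds_input p \<kappa> S \<sigma>" and S: "S \<in> carrier_mat p p" and n: "p \<le> n"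
    and Q: "\<And>\<tau>. holds_input p \<kappa> S \<tau> \<Longrightarrow>
      prim_order p (\<lambda>i j. \<bar>emp_corr S $$ (i, j)\<bar>) (\<lambda>i. iarr \<tau> 1 i 0) (\<lambda>i. rarr \<tau> 2 i 0) \<Longrightarrow> Q \<tau>"
  shows "runs n prim_prog \<sigma> Q"
  unfolding prim_prog_def
proof (rule runs_Seq)
  let ?c = "\<lambda>i j. \<bar>emp_corr S $$ (i, j)\<bar>"
  let ?K = "\<lambda>r \<tau>. holds_input p \<kappa> S \<tau> \<and>
    prim_inv p ?c r (\<lambda>i. iarr \<tau> 1 i 0) (\<lambda>i. rarr \<tau> 2 i 0) (\<lambda>j. rarr \<tau> 1 j 0)"
  let ?Z = "\<lambda>k \<tau>. holds_input p \<kappa> S \<tau> \<and> (\<forall>j<k. rarr \<tau> 1 j 0 = 0)"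
  have main: "runs n (For 1 (IVar 0) prim_step) \<sigma>1 Q" if \<sigma>1: "?Z p \<sigma>1" for \<sigma>1
  proof (rule runs_For[where I = ?K and N = p])
    show "?K 0 (\<sigma>1\<lparr>ivar := (ivar \<sigma>1)(1 := 0)\<rparr>)" using \<sigma>1 by (simp add: prim_inv_def)
  next
    fix r \<tau> assume r: "r < p" and K: "?K r \<tau>" and v: "ivar \<tau> 1 = r"
    show "runs n prim_step \<tau>
        (\<lambda>\<tau>'. ivar \<tau>' 1 = r \<and> ?K (Suc r) (\<tau>'\<lparr>ivar := (ivar \<tau>')(1 := Suc r)\<rparr>))"
      unfolding prim_step_def
    proof (rule runs_Seq, rule runs_select_max[where p = p])
      fix \<tau>1 :: store
      assume 1: "ivar \<tau>1 0 = p" "ivar \<tau>1 1 = ivar \<tau> 1" "rvar \<tau>1 = rvar \<tau>" "iarr \<tau>1 = iarr \<tau>"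
        "rarr \<tau>1 = rarr \<tau>" "ivar \<tau>1 3 < p"
        and max: "\<And>j. j < p \<Longrightarrow> rarr \<tau> 1 j 0 \<le> rarr \<tau> 1 (ivar \<tau>1 3) 0"
      have inp: "holds_input p \<kappa> S \<tau>1" using K 1 by (simp add: holds_input_def)
      show "runs n (Seq (IPut 1 (IVar 1) (ICon 0) (IVar 3))
         (Seq (RPut 2 (IVar 1) (ICon 0) (key_exp (IVar 3)))
         (Seq (RPut 1 (IVar 3) (ICon 0) (RSub (ROfIndex (ICon 0)) (ROfIndex (ICon 1)))) update_keys))) \<tau>1
         (\<lambda>\<tau>'. ivar \<tau>' 1 = r \<and> ?K (Suc r) (\<tau>'\<lparr>ivar := (ivar \<tau>')(1 := Suc r)\<rparr>))"
      proof -
        define b where "b = ivar \<tau>1 3"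
        define \<tau>2 where "\<tau>2 = rarr_upd 1 b 0 (- 1) (rarr_upd 2 r 0 (rarr \<tau> 1 b 0) (iarr_upd 1 r 0 b \<tau>1))"
        have b: "b < p" using 1 by (simp add: b_def)
        have "runs n update_keys \<tau>2
          (\<lambda>\<tau>'. ivar \<tau>' 1 = r \<and> ?K (Suc r) (\<tau>'\<lparr>ivar := (ivar \<tau>')(1 := Suc r)\<rparr>))"
        proof (rule runs_update_keys[OF _ S n _ b])
          show "holds_input p \<kappa> S \<tau>2" using inp by (simp add: \<tau>2_def)
          show "ivar \<tau>2 3 = b" by (simp add: \<tau>2_def b_def)
        next
          fix \<tau>3
          assume 3: "holds_input p \<kappa> S \<tau>3" "ivar \<tau>3 1 = ivar \<tau>2 1" "iarr \<tau>3 = iarr \<tau>2"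
            "rarr \<tau>3 2 = rarr \<tau>2 2"
            and key: "\<And>j. j < p \<Longrightarrow> rarr \<tau>3 1 j 0 =
              (if 0 \<le> rarr \<tau>2 1 j 0 \<and> rarr \<tau>2 1 j 0 < \<bar>emp_corr S $$ (b, j)\<bar>
               then \<bar>emp_corr S $$ (b, j)\<bar> else rarr \<tau>2 1 j 0)"
          have "prim_inv p ?c (Suc r) (\<lambda>i. iarr \<tau>3 1 i 0) (\<lambda>i. rarr \<tau>3 2 i 0)
            (\<lambda>j. rarr \<tau>3 1 j 0)"
          proof (rule prim_inv_step[OF conjunct2[OF K] r b])
            show "rarr \<tau> 1 j 0 \<le> rarr \<tau> 1 b 0" if "j < p" for j
              using max[OF that] by (simp add: b_def)
            show "rarr \<tau>3 1 j 0 = (if j = b then - 1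
              else if 0 \<le> rarr \<tau> 1 j 0 \<and> rarr \<tau> 1 j 0 < \<bar>emp_corr S $$ (b, j)\<bar>
                then \<bar>emp_corr S $$ (b, j)\<bar> else rarr \<tau> 1 j 0)" if "j < p" for j
              using key[OF that] 1 by (simp add: \<tau>2_def)
            show "iarr \<tau>3 1 i 0 = (if i = r then b else iarr \<tau> 1 i 0)" for i
              using 3 1 by (simp add: \<tau>2_def)
            show "rarr \<tau>3 2 i 0 = (if i = r then rarr \<tau> 1 b 0 else rarr \<tau> 2 i 0)" for i
              using 3 1 by (simp add: \<tau>2_def)
          qed
          then show "ivar \<tau>3 1 = r \<and> ?K (Suc r) (\<tau>3\<lparr>ivar := (ivar \<tau>3)(1 := Suc r)\<rparr>)"
            using 3 1 v by (simp add: \<tau>2_def)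
        qed
        then show ?thesis
          using 1 v by (intro runs_Seq runs_IPut runs_RPut) (simp add: \<tau>2_def b_def)
      qed
    qed (use K r n in \<open>auto simp: holds_input_def\<close>)
  next
    fix r \<tau> assume "?K r \<tau>"
    then show "ival (IVar 0) \<tau> = p" by (simp add: holds_input_def)
  next
    fix \<tau> assume "?K p \<tau>"
    then show "Q \<tau>" using Q prim_inv_final by blast
  qed (rule n)
  show "runs n (For 2 (IVar 0) (RPut 1 (IVar 2) (ICon 0) (ROfIndex (ICon 0)))) \<sigma>
      (\<lambda>\<tau>. runs n (For 1 (IVar 0) prim_step) \<tau> Q)"
  proof (rule runs_For[where I = ?Z and N = p])
    fix k \<tau> assume *: "k < p" "?Z k \<tau>" "ivar \<tau> 2 = k"
    then show "runs n (RPut 1 (IVar 2) (ICon 0) (ROfIndex (ICon 0))) \<tau>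
        (\<lambda>\<tau>'. ivar \<tau>' 2 = k \<and> ?Z (Suc k) (\<tau>'\<lparr>ivar := (ivar \<tau>')(2 := Suc k)\<rparr>))"
      by (intro runs_RPut) (auto simp: less_Suc_eq)
  next
    fix k \<tau> assume "?Z k \<tau>"
    then show "ival (IVar 0) \<tau> = p" by (simp add: holds_input_def)
  qed (use \<sigma> n main in auto)
qed

section \<open>Scanning the levels\<close>

abbreviation level_start :: "nat \<Rightarrow> (nat \<Rightarrow> real) \<Rightarrow> nat \<Rightarrow> nat \<Rightarrow> nat" where
  "level_start p w k \<equiv> seg_start (cut_at w (real k / real p))"

text \<open>Advances the start of the current run to the one of position \<open>i\<close> of the inner loop.\<close>

definition seg_step :: "rexp \<Rightarrow> com" where
  "seg_step lam = Cond (RLess lam (RGet 2 (IVar 2) (ICon 0))) Skip (ISet 4 (IVar 2))"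

definition entry_exp :: "nat \<Rightarrow> nat \<Rightarrow> rexp" where
  "entry_exp u v = RGet 0 (IGet 1 (IAdd (IVar 4) (ICon u)) (ICon 0))
     (IGet 1 (IAdd (IVar 4) (ICon v)) (ICon 0))"

text \<open>Chooses among the determinant expressions of sizes \<open>1, \<dots>, m\<close> by the length of the current run, which
  is \<open>i + 1 - a\<close> at position \<open>i\<close> of a run that starts at \<open>a\<close>; the cascade has constant cost.\<close>

primrec lndet :: "(nat \<Rightarrow> rexp) \<Rightarrow> nat \<Rightarrow> com" where
  "lndet D 0 = Skip"
| "lndet D (Suc l) = Cond (IEq (ISub (IVar 2) (IVar 4)) (ICon l))
     (RSet 1 (RLn (D (Suc l)))) (lndet D l)"

definition len_exp :: rexp where
  "len_exp = ROfIndex (ISub (IAdd (IVar 2) (ICon 1)) (IVar 4))"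

definition store_term :: com where
  "store_term = RPut 3 (IAdd (IVar 2) (ICon 1)) (ICon 0)
     (RAdd (RGet 3 (IVar 4) (ICon 0))
       (RAdd (RDiv (RVar 1) (ROfIndex (IVar 0))) (RMul (RVar 0) (RMul len_exp len_exp))))"

definition score_step :: "(nat \<Rightarrow> rexp) \<Rightarrow> nat \<Rightarrow> com" where
  "score_step D m = Seq (seg_step (RDiv (ROfIndex (ISub (IVar 0) (IVar 1))) (ROfIndex (IVar 0))))
     (Cond (ILess (ISub (IVar 2) (IVar 4)) (ICon m)) (Seq (lndet D m) store_term) (ISet 5 (ICon 1)))"

definition score :: "(nat \<Rightarrow> rexp) \<Rightarrow> nat \<Rightarrow> com" where
  "score D m = Seq (ISet 5 (ICon 0)) (Seq (RPut 3 (ICon 0) (ICon 0) (ROfIndex (ICon 0)))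
     (For 2 (IVar 0) (score_step D m)))"

text \<open>The levels are visited from \<open>p\<close> downwards (\<open>k = p - q\<close> in round \<open>q\<close>).  Round \<open>0\<close> must overwrite
  the arbitrary initial value of the best level, and can do so because level \<open>p\<close> is admissible.\<close>

definition keep_better :: com where
  "keep_better = Cond (BAnd (IEq (IVar 5) (ICon 0)) (BNot (BAnd (BNot (IEq (IVar 1) (ICon 0)))
         (BNot (RLess (RGet 3 (IVar 0) (ICon 0)) (RVar 2))))))
     (Seq (RSet 2 (RGet 3 (IVar 0) (ICon 0))) (ISet 6 (ISub (IVar 0) (IVar 1)))) Skip"

definition select_level :: "(nat \<Rightarrow> rexp) \<Rightarrow> nat \<Rightarrow> com" where
  "select_level D m = For 1 (IAdd (IVar 0) (ICon 1)) (Seq (score D m) keep_better)"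

definition write_labels :: com where
  "write_labels = For 2 (IVar 0) (Seq (seg_step (RDiv (ROfIndex (IVar 6)) (ROfIndex (IVar 0))))
     (IPut 0 (IGet 1 (IVar 2) (ICon 0)) (ICon 0) (IVar 4)))"

definition block_prog :: "(nat \<Rightarrow> rexp) \<Rightarrow> nat \<Rightarrow> com" where
  "block_prog D m = Seq prim_prog (Seq (select_level D m) write_labels)"

text \<open>The outcome of Prim's algorithm, which all later steps leave unchanged.\<close>

definition ready :: "nat \<Rightarrow> real \<Rightarrow> real mat \<Rightarrow> (nat \<Rightarrow> nat) \<Rightarrow> (nat \<Rightarrow> real) \<Rightarrow> store \<Rightarrow> bool" where
  "ready p \<kappa> S \<pi> w \<tau> \<longleftrightarrow> holds_input p \<kappa> S \<tau> \<and>
     (\<forall>i<p. iarr \<tau> 1 i 0 = \<pi> i) \<and> (\<forall>i<p. rarr \<tau> 2 i 0 = w i)"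

lemma ready_upd [simp]:
  "f 0 = ivar \<sigma> 0 \<Longrightarrow> ready p \<kappa> S \<pi> w (\<sigma>\<lparr>ivar := f\<rparr>) = ready p \<kappa> S \<pi> w \<sigma>"
  "g 0 = rvar \<sigma> 0 \<Longrightarrow> ready p \<kappa> S \<pi> w (\<sigma>\<lparr>rvar := g\<rparr>) = ready p \<kappa> S \<pi> w \<sigma>"
  "a \<noteq> 1 \<Longrightarrow> ready p \<kappa> S \<pi> w (iarr_upd a i j v \<sigma>) = ready p \<kappa> S \<pi> w \<sigma>"
  "a \<noteq> 0 \<Longrightarrow> a \<noteq> 2 \<Longrightarrow> ready p \<kappa> S \<pi> w (rarr_upd a i j y \<sigma>) = ready p \<kappa> S \<pi> w \<sigma>"
  by (simp_all add: ready_def)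

lemma ready_ivar: "ready p \<kappa> S \<pi> w \<tau> \<Longrightarrow> ivar \<tau> 0 = p"
  and ready_rvar: "ready p \<kappa> S \<pi> w \<tau> \<Longrightarrow> rvar \<tau> 0 = \<kappa>"
  by (simp_all add: ready_def holds_input_def)

text \<open>Since \<open>w 0\<close> does not exceed the level, position \<open>0\<close> sets the start afresh, whatever the register
  contained.\<close>

lemma runs_seg_step:
  assumes rd: "ready p \<kappa> S \<pi> w \<tau>" and k: "ivar \<tau> 2 = k" "k < p"
    and prev: "0 < k \<Longrightarrow> ivar \<tau> 4 = seg_start (cut_at w (rval lam \<tau>)) (k - 1)"
    and first: "w 0 \<le> rval lam \<tau>"
    and Q: "Q (\<tau>\<lparr>ivar := (ivar \<tau>)(4 := seg_start (cut_at w (rval lam \<tau>)) k)\<rparr>)"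
  shows "runs n (seg_step lam) \<tau> Q"
  unfolding seg_step_def
proof (rule runs_Cond)
  have w: "rarr \<tau> 2 k 0 = w k" using rd k by (simp add: ready_def)
  {
    assume "bval (RLess lam (RGet 2 (IVar 2) (ICon 0))) \<tau>"
    then have less: "rval lam \<tau> < w k" using k w by simp
    then have "0 < k" using first by (cases k) auto
    then obtain k' where "k = Suc k'" by (cases k) auto
    then have "seg_start (cut_at w (rval lam \<tau>)) k = ivar \<tau> 4" using prev less by simp
    then have "\<tau>\<lparr>ivar := (ivar \<tau>)(4 := seg_start (cut_at w (rval lam \<tau>)) k)\<rparr> = \<tau>" by simp
    then show "runs n Skip \<tau> Q" using Q by (intro runs_Skip) simp
  next
    assume "\<not> bval (RLess lam (RGet 2 (IVar 2) (ICon 0))) \<tau>"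
    then have "\<not> rval lam \<tau> < w k" using k w by simp
    then have "seg_start (cut_at w (rval lam \<tau>)) k = k" by (cases k) auto
    then show "runs n (ISet 4 (IVar 2)) \<tau> Q" using Q k by (intro runs_ISet) simp
  }
qed

lemma runs_lndet:
  assumes "ivar \<tau> 2 - ivar \<tau> 4 < l"
    and "Q (\<tau>\<lparr>rvar := (rvar \<tau>)(1 := ln (rval (D (Suc (ivar \<tau> 2 - ivar \<tau> 4))) \<tau>))\<rparr>)"
  shows "runs n (lndet D l) \<tau> Q"
  using assms(1)
proof (induction l)
  case (Suc l)
  show ?case unfolding lndet.simps
  proof (rule runs_Cond)
    assume "bval (IEq (ISub (IVar 2) (IVar 4)) (ICon l)) \<tau>"
    then show "runs n (RSet 1 (RLn (D (Suc l)))) \<tau> Q" using assms(2) by (intro runs_RSet) simp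
  next
    assume "\<not> bval (IEq (ISub (IVar 2) (IVar 4)) (ICon l)) \<tau>"
    then show "runs n (lndet D l) \<tau> Q" using Suc by simp
  qed
qed simp

text \<open>Once a run exceeds \<open>m\<close>, entries of \<open>V\<close> are missing and later entries are meaningless, so the
  recursion is only claimed as long as the level counts as admissible.\<close>

lemma runs_score:
  assumes rd: "ready p \<kappa> S \<pi> w \<sigma>" and n: "p \<le> n" and p: "0 < p" and w0: "w 0 = 0"
    and D: "\<And>l \<tau>. rval (D l) \<tau> = det (mat l l (\<lambda>(u, v). rval (entry_exp u v) \<tau>))"
    and \<pi>: "\<And>i. i < p \<Longrightarrow> \<pi> i < p"
    and q: "ivar \<sigma> 1 = q"
    and st: "st = level_start p w (p - q)"
    and Q: "\<And>\<tau>. ready p \<kappa> S \<pi> w \<tau> \<Longrightarrow> ivar \<tau> 1 = q \<Longrightarrow> ivar \<tau> 6 = ivar \<sigma> 6 \<Longrightarrow>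
      rvar \<tau> 2 = rvar \<sigma> 2 \<Longrightarrow> ivar \<tau> 5 = 0 \<longleftrightarrow> (\<forall>i<p. i - st i < m) \<Longrightarrow>
      (ivar \<tau> 5 = 0 \<Longrightarrow> rarr \<tau> 3 0 0 = 0 \<and> (\<forall>i<p. rarr \<tau> 3 (Suc i) 0 =
        rarr \<tau> 3 (st i) 0 + seg_term p \<kappa> S \<pi> (st i) (Suc i - st i))) \<Longrightarrow> Q \<tau>"
  shows "runs n (score D m) \<sigma> Q"
  unfolding score_def
proof (intro runs_Seq runs_ISet runs_RPut)
  let ?lam = "RDiv (ROfIndex (ISub (IVar 0) (IVar 1))) (ROfIndex (IVar 0))"
  let ?I = "\<lambda>k \<tau>. ready p \<kappa> S \<pi> w \<tau> \<and> ivar \<tau> 1 = q \<and> ivar \<tau> 6 = ivar \<sigma> 6 \<and> rvar \<tau> 2 = rvar \<sigma> 2 \<and>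
    (0 < k \<longrightarrow> ivar \<tau> 4 = st (k - 1)) \<and> (ivar \<tau> 5 = 0 \<longleftrightarrow> (\<forall>i<k. i - st i < m)) \<and>
    rarr \<tau> 3 0 0 = 0 \<and> (ivar \<tau> 5 = 0 \<longrightarrow> (\<forall>i<k. rarr \<tau> 3 (Suc i) 0 =
        rarr \<tau> 3 (st i) 0 + seg_term p \<kappa> S \<pi> (st i) (Suc i - st i)))"
  have st_le: "st i \<le> i" for i unfolding st by (rule seg_start_le)
  have loop: "runs n (For 2 (IVar 0) (score_step D m)) \<sigma>1 Q"
    if \<sigma>1: "ready p \<kappa> S \<pi> w \<sigma>1" "ivar \<sigma>1 1 = q" "ivar \<sigma>1 6 = ivar \<sigma> 6" "rvar \<sigma>1 2 = rvar \<sigma> 2"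
      "ivar \<sigma>1 5 = 0" "rarr \<sigma>1 3 0 0 = 0" for \<sigma>1
  proof (rule runs_For[where I = ?I and N = p])
    fix k \<tau> assume k: "k < p" and I: "?I k \<tau>" and v: "ivar \<tau> 2 = k"
    have lam: "rval ?lam \<tau> = real (p - q) / real p" using ready_ivar[OF conjunct1[OF I]] I by simp
    define \<tau>1 where "\<tau>1 = \<tau>\<lparr>ivar := (ivar \<tau>)(4 := st k)\<rparr>"
    define x where "x = ln (det (mat (Suc (k - st k)) (Suc (k - st k))
      (\<lambda>(u, v). S $$ (\<pi> (st k + u), \<pi> (st k + v)))))"
    have len: "Suc (k - st k) = Suc k - st k" using st_le[of k] by simp
    have rd1: "ready p \<kappa> S \<pi> w \<tau>1" using I by (simp add: \<tau>1_def)
    \<comment> \<open>The expression reads positions up to \<open>k\<close> only, where the order is known.\<close>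
    have "mat (Suc (k - st k)) (Suc (k - st k)) (\<lambda>(u, v). rval (entry_exp u v) \<tau>1) =
        mat (Suc (k - st k)) (Suc (k - st k)) (\<lambda>(u, v). S $$ (\<pi> (st k + u), \<pi> (st k + v)))"
    proof (rule eq_matI)
      fix u v' assume "u < dim_row (mat (Suc (k - st k)) (Suc (k - st k))
          (\<lambda>(u, v). S $$ (\<pi> (st k + u), \<pi> (st k + v))))"
        and "v' < dim_col (mat (Suc (k - st k)) (Suc (k - st k))
          (\<lambda>(u, v). S $$ (\<pi> (st k + u), \<pi> (st k + v))))"
      then have uv: "u < Suc (k - st k)" "v' < Suc (k - st k)" by simp_all
      then have "st k + u < p" "st k + v' < p" using k st_le[of k] by linarith+
      then show "mat (Suc (k - st k)) (Suc (k - st k)) (\<lambda>(u, v). rval (entry_exp u v) \<tau>1) $$ (u, v')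
        = mat (Suc (k - st k)) (Suc (k - st k))
            (\<lambda>(u, v). S $$ (\<pi> (st k + u), \<pi> (st k + v))) $$ (u, v')"
        using uv rd1 \<pi> by (simp add: entry_exp_def ready_def holds_input_def \<tau>1_def)
    qed simp_all
    then have Dx: "ln (rval (D (Suc (k - st k))) \<tau>1) = x" by (simp add: D x_def)
    let ?R = "\<lambda>\<tau>'. ivar \<tau>' 2 = k \<and> ?I (Suc k) (\<tau>'\<lparr>ivar := (ivar \<tau>')(2 := Suc k)\<rparr>)"
    show "runs n (score_step D m) \<tau> ?R"
      unfolding score_step_def
    proof (rule runs_Seq, rule runs_seg_step[OF conjunct1[OF I] v k], unfold lam st[symmetric])
      show "ivar \<tau> 4 = st (k - 1)" if "0 < k" using I that by blast
      show "w 0 \<le> real (p - q) / real p" by (simp add: w0)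
      have "runs n (Cond (ILess (ISub (IVar 2) (IVar 4)) (ICon m)) (Seq (lndet D m) store_term)
          (ISet 5 (ICon 1))) \<tau>1 ?R"
      proof (rule runs_Cond)
        assume "bval (ILess (ISub (IVar 2) (IVar 4)) (ICon m)) \<tau>1"
        then have short: "k - st k < m" using v by (simp add: \<tau>1_def)
        define t where "t = rarr \<tau> 3 (st k) 0 + seg_term p \<kappa> S \<pi> (st k) (Suc k - st k)"
        have t: "t = rarr \<tau> 3 (st k) 0 + (x / real p + \<kappa> * (real (Suc k - st k))\<^sup>2)"
          unfolding t_def seg_term_def x_def len ..
        have R: "?R (rarr_upd 3 (Suc k) 0 t (\<tau>1\<lparr>rvar := (rvar \<tau>1)(1 := x)\<rparr>))"
        proof -
          \<comment> \<open>Writing entry \<open>k + 1\<close> does not disturb the entries that the recursion has read.\<close>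
          have "st i \<noteq> Suc k" if "i < k" for i using that st_le[of i] by simp
          moreover have "st k \<noteq> Suc k" using st_le[of k] by simp
          ultimately show ?thesis
            using I v short by (auto simp: \<tau>1_def less_Suc_eq t_def)
        qed
        show "runs n (Seq (lndet D m) store_term) \<tau>1 ?R"
          unfolding store_term_def
        proof (intro runs_Seq runs_lndet runs_RPut)
          show "ivar \<tau>1 2 - ivar \<tau>1 4 < m" using short v by (simp add: \<tau>1_def)
        next
          let ?\<tau>2 = "\<tau>1\<lparr>rvar := (rvar \<tau>1)(1 := ln (rval (D (Suc (ivar \<tau>1 2 - ivar \<tau>1 4))) \<tau>1))\<rparr>"
          have "ivar \<tau>1 2 = k" "ivar \<tau>1 4 = st k" using v by (simp_all add: \<tau>1_def)
          then have 2: "?\<tau>2 = \<tau>1\<lparr>rvar := (rvar \<tau>1)(1 := x)\<rparr>" using Dx by simp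
          show "?R (rarr_upd 3 (ival (IAdd (IVar 2) (ICon 1)) ?\<tau>2) (ival (ICon 0) ?\<tau>2)
            (rval (RAdd (RGet 3 (IVar 4) (ICon 0)) (RAdd (RDiv (RVar 1) (ROfIndex (IVar 0)))
              (RMul (RVar 0) (RMul len_exp len_exp)))) ?\<tau>2) ?\<tau>2)"
          proof -
            have "rval (RAdd (RGet 3 (IVar 4) (ICon 0)) (RAdd (RDiv (RVar 1) (ROfIndex (IVar 0)))
              (RMul (RVar 0) (RMul len_exp len_exp)))) (\<tau>1\<lparr>rvar := (rvar \<tau>1)(1 := x)\<rparr>) = t"
              using v ready_ivar[OF rd1] ready_rvar[OF rd1]
              by (simp add: t len_exp_def \<tau>1_def power2_eq_square)
            moreover have "ival (IAdd (IVar 2) (ICon 1)) (\<tau>1\<lparr>rvar := (rvar \<tau>1)(1 := x)\<rparr>) = Suc k"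
              using v by (simp add: \<tau>1_def)
            ultimately show ?thesis unfolding 2 using R by simp
          qed
        qed
      next
        assume "\<not> bval (ILess (ISub (IVar 2) (IVar 4)) (ICon m)) \<tau>1"
        then have "\<not> k - st k < m" using v by (simp add: \<tau>1_def)
        then have "\<not> (\<forall>i<Suc k. i - st i < m)" by blast
        then show "runs n (ISet 5 (ICon 1)) \<tau>1 ?R"
          using I v by (intro runs_ISet) (simp add: \<tau>1_def)
      qed
      then show "runs n (Cond (ILess (ISub (IVar 2) (IVar 4)) (ICon m)) (Seq (lndet D m) store_term)
          (ISet 5 (ICon 1))) (\<tau>\<lparr>ivar := (ivar \<tau>)(4 := st k)\<rparr>) ?R"
        unfolding \<tau>1_def .
    qed
  next
    fix k \<tau> assume "?I k \<tau>"
    then show "ival (IVar 0) \<tau> = p" using ready_ivar[of p \<kappa> S \<pi> w \<tau>] by simp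
  qed (use \<sigma>1 n Q in auto)
  show "runs n (For 2 (IVar 0) (score_step D m))
      (rarr_upd 3 (ival (ICon 0) (\<sigma>\<lparr>ivar := (ivar \<sigma>)(5 := ival (ICon 0) \<sigma>)\<rparr>))
        (ival (ICon 0) (\<sigma>\<lparr>ivar := (ivar \<sigma>)(5 := ival (ICon 0) \<sigma>)\<rparr>))
        (rval (ROfIndex (ICon 0)) (\<sigma>\<lparr>ivar := (ivar \<sigma>)(5 := ival (ICon 0) \<sigma>)\<rparr>))
        (\<sigma>\<lparr>ivar := (ivar \<sigma>)(5 := ival (ICon 0) \<sigma>)\<rparr>)) Q"
    by (rule loop) (use rd q in simp_all)
qed

text \<open>\<open>ok\<close> and \<open>val\<close> stand for the admissibility and the value of a level.  The invariant of round \<open>q\<close>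
  covers the levels \<open>k > p - q\<close>.\<close>

lemma runs_select_level:
  assumes rd: "ready p \<kappa> S \<pi> w \<sigma>" and n: "Suc p \<le> n" and p: "0 < p" and w0: "w 0 = 0"
    and D: "\<And>l \<tau>. rval (D l) \<tau> = det (mat l l (\<lambda>(u, v). rval (entry_exp u v) \<tau>))"
    and \<pi>: "\<And>i. i < p \<Longrightarrow> \<pi> i < p"
    and ok: "\<And>k. k \<le> p \<Longrightarrow> ok k \<longleftrightarrow> (\<forall>i<p. i - level_start p w k i < m)"
    and val: "\<And>k V. k \<le> p \<Longrightarrow> V 0 = 0 \<Longrightarrow> (\<And>i. i < p \<Longrightarrow> V (Suc i) = V (level_start p w k i) +
        seg_term p \<kappa> S \<pi> (level_start p w k i) (Suc i - level_start p w k i)) \<Longrightarrow> V p = val k"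
    and okp: "ok p"
    and Q: "\<And>\<tau>. ready p \<kappa> S \<pi> w \<tau> \<Longrightarrow> ivar \<tau> 6 \<le> p \<Longrightarrow> ok (ivar \<tau> 6) \<Longrightarrow>
      (\<And>k. k \<le> p \<Longrightarrow> ok k \<Longrightarrow> val (ivar \<tau> 6) \<le> val k) \<Longrightarrow> Q \<tau>"
  shows "runs n (select_level D m) \<sigma> Q"
  unfolding select_level_def
proof -
  let ?I = "\<lambda>q \<tau>. ready p \<kappa> S \<pi> w \<tau> \<and> (0 < q \<longrightarrow> ivar \<tau> 6 \<le> p \<and> ok (ivar \<tau> 6) \<and>
    rvar \<tau> 2 = val (ivar \<tau> 6) \<and> (\<forall>k\<le>p. p < k + q \<longrightarrow> ok k \<longrightarrow> val (ivar \<tau> 6) \<le> val k))"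
  show "runs n (For 1 (IAdd (IVar 0) (ICon 1)) (Seq (score D m) keep_better)) \<sigma> Q"
  proof (rule runs_For[where I = ?I and N = "Suc p"])
    fix q \<tau> assume q: "q < Suc p" and I: "?I q \<tau>" and v: "ivar \<tau> 1 = q"
    let ?R = "\<lambda>\<tau>'. ivar \<tau>' 1 = q \<and> ?I (Suc q) (\<tau>'\<lparr>ivar := (ivar \<tau>')(1 := Suc q)\<rparr>)"
    have new: "p < k + Suc q \<longleftrightarrow> p < k + q \<or> k = p - q" for k using q by auto
    show "runs n (Seq (score D m) keep_better) \<tau> ?R"
    proof (rule runs_Seq, rule runs_score[OF conjunct1[OF I] _ p w0 D \<pi> v refl])
      show "p \<le> n" using n by simp
    next
      fix \<tau>1
      assume 1: "ready p \<kappa> S \<pi> w \<tau>1" "ivar \<tau>1 1 = q" "ivar \<tau>1 6 = ivar \<tau> 6" "rvar \<tau>1 2 = rvar \<tau> 2"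
        and ok1: "ivar \<tau>1 5 = 0 \<longleftrightarrow> (\<forall>i<p. i - level_start p w (p - q) i < m)"
        and V: "ivar \<tau>1 5 = 0 \<Longrightarrow> rarr \<tau>1 3 0 0 = 0 \<and> (\<forall>i<p. rarr \<tau>1 3 (Suc i) 0 =
          rarr \<tau>1 3 (level_start p w (p - q) i) 0 + seg_term p \<kappa> S \<pi> (level_start p w (p - q) i)
            (Suc i - level_start p w (p - q) i))"
      have ok': "ivar \<tau>1 5 = 0 \<longleftrightarrow> ok (p - q)" using ok1 ok[of "p - q"] by simp
      have val': "rarr \<tau>1 3 p 0 = val (p - q)" if "ok (p - q)"
        using val[of "p - q" "\<lambda>i. rarr \<tau>1 3 i 0"] V ok' that by simp
      have zero: "ivar \<tau>1 0 = p" by (rule ready_ivar[OF 1(1)])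
      show "runs n keep_better \<tau>1 ?R"
        unfolding keep_better_def
      proof (intro runs_Cond runs_Seq runs_RSet runs_ISet runs_Skip)
        assume "bval (BAnd (IEq (IVar 5) (ICon 0)) (BNot (BAnd (BNot (IEq (IVar 1) (ICon 0)))
         (BNot (RLess (RGet 3 (IVar 0) (ICon 0)) (RVar 2)))))) \<tau>1"
        then have okq: "ok (p - q)" and better: "q = 0 \<or> rarr \<tau>1 3 p 0 < rvar \<tau> 2"
          using ok' 1 zero by auto
        have "val (p - q) \<le> val k" if "k \<le> p" "p < k + Suc q" "ok k" for k
        proof (cases "k = p - q")
          case False
          then have "0 < q" "p < k + q" using that new by auto
          then show ?thesis using I better that val'[OF okq] by force
        qed simp
        moreover let ?\<tau>2 = "\<tau>1\<lparr>rvar := (rvar \<tau>1)(2 := rval (RGet 3 (IVar 0) (ICon 0)) \<tau>1)\<rparr>"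
        have "ival (ISub (IVar 0) (IVar 1)) ?\<tau>2 = p - q"
          "rval (RGet 3 (IVar 0) (ICon 0)) \<tau>1 = val (p - q)"
          using 1 zero val'[OF okq] by simp_all
        ultimately show "?R (?\<tau>2\<lparr>ivar := (ivar ?\<tau>2)(6 := ival (ISub (IVar 0) (IVar 1)) ?\<tau>2)\<rparr>)"
          using 1 okq by simp
      next
        assume *: "\<not> bval (BAnd (IEq (IVar 5) (ICon 0)) (BNot (BAnd (BNot (IEq (IVar 1) (ICon 0)))
         (BNot (RLess (RGet 3 (IVar 0) (ICon 0)) (RVar 2)))))) \<tau>1"
        then have worse: "rvar \<tau> 2 \<le> val (p - q) \<and> 0 < q" if "ok (p - q)"
          using that ok' 1 zero val' by auto
        then have "0 < q" using okp by (cases q) auto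
        have "val (ivar \<tau> 6) \<le> val k" if "k \<le> p" "p < k + Suc q" "ok k" for k
          using that new[of k] worse I \<open>0 < q\<close> by (cases "k = p - q") auto
        then show "?R \<tau>1" using 1 I \<open>0 < q\<close> by simp
      qed
    qed
  next
    fix k \<tau> assume "?I k \<tau>"
    then show "ival (IAdd (IVar 0) (ICon 1)) \<tau> = Suc p" using ready_ivar[of p \<kappa> S \<pi> w \<tau>] by simp
  next
    fix \<tau> assume "?I (Suc p) \<tau>"
    then show "Q \<tau>" by (intro Q) auto
  qed (use rd n in auto)
qed

lemma runs_write_labels:
  assumes rd: "ready p \<kappa> S \<pi> w \<sigma>" and n: "p \<le> n" and w0: "w 0 = 0"
    and inj: "inj_on \<pi> {..<p}"
    and Q: "\<And>\<tau>. (\<And>i. i < p \<Longrightarrow> iarr \<tau> 0 (\<pi> i) 0 = level_start p w (ivar \<sigma> 6) i) \<Longrightarrow> Q \<tau>"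
  shows "runs n write_labels \<sigma> Q"
  unfolding write_labels_def
proof -
  let ?lam = "RDiv (ROfIndex (IVar 6)) (ROfIndex (IVar 0))"
  let ?st = "level_start p w (ivar \<sigma> 6)"
  let ?I = "\<lambda>k \<tau>. ready p \<kappa> S \<pi> w \<tau> \<and> ivar \<tau> 6 = ivar \<sigma> 6 \<and> (0 < k \<longrightarrow> ivar \<tau> 4 = ?st (k - 1)) \<and>
    (\<forall>i<k. iarr \<tau> 0 (\<pi> i) 0 = ?st i)"
  show "runs n (For 2 (IVar 0) (Seq (seg_step ?lam)
     (IPut 0 (IGet 1 (IVar 2) (ICon 0)) (ICon 0) (IVar 4)))) \<sigma> Q"
  proof (rule runs_For[where I = ?I and N = p])
    fix k \<tau> assume k: "k < p" and I: "?I k \<tau>" and v: "ivar \<tau> 2 = k"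
    have lam: "rval ?lam \<tau> = real (ivar \<sigma> 6) / real p" using ready_ivar[OF conjunct1[OF I]] I by simp
    have ord: "iarr \<tau> 1 k 0 = \<pi> k" using I k by (simp add: ready_def)
    have fresh: "\<pi> i \<noteq> \<pi> k" if "i < k" for i using inj_onD[OF inj, of i k] that k by auto
    show "runs n (Seq (seg_step ?lam) (IPut 0 (IGet 1 (IVar 2) (ICon 0)) (ICon 0) (IVar 4))) \<tau>
        (\<lambda>\<tau>'. ivar \<tau>' 2 = k \<and> ?I (Suc k) (\<tau>'\<lparr>ivar := (ivar \<tau>')(2 := Suc k)\<rparr>))"
    proof (rule runs_Seq, rule runs_seg_step[OF conjunct1[OF I] v k], unfold lam)
      show "ivar \<tau> 4 = ?st (k - 1)" if "0 < k" using I that by blast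
      show "w 0 \<le> real (ivar \<sigma> 6) / real p" by (simp add: w0)
      show "runs n (IPut 0 (IGet 1 (IVar 2) (ICon 0)) (ICon 0) (IVar 4))
          (\<tau>\<lparr>ivar := (ivar \<tau>)(4 := ?st k)\<rparr>)
          (\<lambda>\<tau>'. ivar \<tau>' 2 = k \<and> ?I (Suc k) (\<tau>'\<lparr>ivar := (ivar \<tau>')(2 := Suc k)\<rparr>))"
        using I v ord fresh by (intro runs_IPut) (auto simp: less_Suc_eq)
    qed
  next
    fix k \<tau> assume "?I k \<tau>"
    then show "ival (IVar 0) \<tau> = p" using ready_ivar[of p \<kappa> S \<pi> w \<tau>] by simp
  qed (use rd n Q in auto)
qed

lemma loop_depth_block_prog: "loop_depth (block_prog D m) = 2"
proof -
  have "loop_depth (lndet D m) = 0" by (induction m) simp_all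
  then show ?thesis
    by (simp add: block_prog_def prim_prog_def prim_step_def select_max_def update_keys_def For_def
        select_level_def score_def score_step_def seg_step_def store_term_def keep_better_def
        write_labels_def)
qed

section \<open>The computed partition is a minimizer\<close>

text \<open>Here \<open>B(S\<^sub>B) = B\<close> for \<open>B = B\<^sub>\<lambda>\<close>: each correlation above the threshold is a nonzero entry of \<open>S\<^sub>B\<close>,
  and all nonzero entries of \<open>S\<^sub>B\<close> lie within groups.\<close>

lemma block_structure_block_restrict_threshold:
  assumes S: "S \<in> carrier_mat p p" and lam: "0 \<le> lam"
    and part: "threshold_partition S lam = label_partition p lab"
  shows "block_structure (block_restrict S (label_partition p lab)) = label_partition p lab"
proof -
  let ?A = "corr_threshold (emp_corr S) lam" and ?A' = "block_restrict S (label_partition p lab)"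
  have A: "square_mat ?A" "dim_row ?A = p"
    using S by (auto simp: corr_threshold_def emp_corr_def)
  have A': "square_mat ?A'" "dim_row ?A' = p"
    using S by (auto simp: block_restrict_def)
  have str: "block_structure ?A = label_partition p lab"
    using part by (simp add: threshold_partition_def)
  have entry: "?A' $$ (i, j) = (if lab i = lab j then S $$ (i, j) else 0)" if "i < p" "j < p" for i j
    using S that by (auto simp: block_restrict_def label_partition_def)
  have same: "lab i = lab j" if ij: "i < p" "j < p" "?A $$ (i, j) \<noteq> 0" for i j
  proof -
    have "(i, j) \<in> conn_rel ?A" "(i, i) \<in> conn_rel ?A"
      using ij A(2) by (simp_all add: conn_rel_def Let_def r_into_rtrancl)
    then have "i \<in> conn_rel ?A `` {i}" "j \<in> conn_rel ?A `` {i}" by simp_all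
    moreover have "conn_rel ?A `` {i} \<in> {0..<p} // conn_rel ?A" using ij by (intro quotientI) simp
    then have "conn_rel ?A `` {i} \<in> label_partition p lab"
      using block_structure_eq_components[OF A(1)] str A(2) by simp
    then obtain x where "conn_rel ?A `` {i} = {y. y < p \<and> lab y = lab x}"
      unfolding label_partition_def by blast
    ultimately show ?thesis by simp
  qed
  show ?thesis
  proof (rule block_structure_cong[OF A(1) A'(1) A(2) A'(2) str])
    fix i j assume ij: "i < p" "j < p"
    show "?A' $$ (i, j) \<noteq> 0" if "?A $$ (i, j) \<noteq> 0"
      using that ij S lam same[OF ij that] entry[OF ij]
      by (auto simp: corr_threshold_def emp_corr_def split: if_splits)
    show "lab i = lab j" if "?A' $$ (i, j) \<noteq> 0"
      using that entry[OF ij] by (auto split: if_splits)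
  qed
qed

lemma abs_emp_corr_le_1:
  assumes "i < p" "j < p"
  shows "\<bar>emp_corr (emp_cov p n X) $$ (i, j)\<bar> \<le> 1"
proof -
  define a where "a l = (X l - sample_mean p n X) $ i" for l
  define b where "b l = (X l - sample_mean p n X) $ j" for l
  let ?S = "emp_cov p n X"
  have ij: "?S $$ (i, j) = (\<Sum>l<n. a l * b l) / real n"
    and ii: "?S $$ (i, i) = (\<Sum>l<n. (a l)\<^sup>2) / real n"
    and jj: "?S $$ (j, j) = (\<Sum>l<n. (b l)\<^sup>2) / real n"
    using assms by (simp_all add: emp_cov_def a_def b_def power2_eq_square)
  have "\<bar>\<Sum>l<n. a l * b l\<bar> \<le> (\<Sum>l<n. \<bar>a l\<bar> * \<bar>b l\<bar>)"
    using sum_abs[of "\<lambda>l. a l * b l" "{..<n}"] by (simp add: abs_mult)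
  also have "\<dots> \<le> L2_set a {..<n} * L2_set b {..<n}" by (rule L2_set_mult_ineq)
  finally have "\<bar>?S $$ (i, j)\<bar> \<le> L2_set a {..<n} * L2_set b {..<n} / real n"
    unfolding ij by (simp add: divide_right_mono)
  also have "\<dots> = sqrt (?S $$ (i, i) * ?S $$ (j, j))"
    unfolding ii jj L2_set_def by (simp add: real_sqrt_mult real_sqrt_divide)
  finally have "\<bar>?S $$ (i, j)\<bar> \<le> sqrt (?S $$ (i, i) * ?S $$ (j, j))" .
  moreover have "emp_corr ?S $$ (i, j) = ?S $$ (i, j) / sqrt (?S $$ (i, i) * ?S $$ (j, j))"
    using assms by (simp add: emp_corr_def emp_cov_def)
  moreover have "\<bar>x / y\<bar> \<le> 1" if "\<bar>x\<bar> \<le> y" for x y :: real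
    using that by (cases "y = 0") (simp_all add: abs_divide)
  ultimately show ?thesis by simp
qed

lemma output_partition_eq: "output_partition p \<tau> = label_partition p (\<lambda>x. iarr \<tau> 0 x 0)"
  by (simp add: output_partition_def label_partition_def)

text \<open>It remains to identify the grid of candidate thresholds with the admissible levels: admissibility
  passes to higher levels, as raising the level only adds cuts, so that \<open>start_index\<close> is a
  threshold for it.\<close>

lemma runs_block_prog:
  assumes m: "1 \<le> m" and p: "1 \<le> p" and n: "Suc p \<le> n"
    and S: "S \<in> carrier_mat p p" and pd: "pos_def_mat S"
    and corr: "\<And>i j. i < p \<Longrightarrow> j < p \<Longrightarrow> \<bar>emp_corr S $$ (i, j)\<bar> \<le> 1"
    and D: "\<And>l \<tau>. rval (D l) \<tau> = det (mat l l (\<lambda>(u, v). rval (entry_exp u v) \<tau>))"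
    and inp: "holds_input p \<kappa> S \<sigma>"
  shows "runs n (block_prog D m) \<sigma> (\<lambda>\<tau>. is_block_estimate m \<kappa> S (output_partition p \<tau>))"
  unfolding block_prog_def
proof (rule runs_Seq, rule runs_prim_prog[OF inp S])
  show "p \<le> n" using n by simp
next
  let ?c = "\<lambda>i j. \<bar>emp_corr S $$ (i, j)\<bar>"
  fix \<tau>1
  assume inp1: "holds_input p \<kappa> S \<tau>1"
    and prim1: "prim_order p ?c (\<lambda>i. iarr \<tau>1 1 i 0) (\<lambda>i. rarr \<tau>1 2 i 0)"
  define \<pi> where "\<pi> i = iarr \<tau>1 1 i 0" for i
  define w where "w i = rarr \<tau>1 2 i 0" for i
  have prim: "prim_order p ?c \<pi> w" using prim1 unfolding \<pi>_def w_def .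
  have rd: "ready p \<kappa> S \<pi> w \<tau>1" using inp1 by (simp add: ready_def \<pi>_def w_def)
  have bij: "bij_betw \<pi> {..<p} {..<p}" using prim by (simp add: prim_order_def)
  have inj: "inj_on \<pi> {..<p}" using bij by (simp add: bij_betw_def)
  have \<pi>: "\<pi> i < p" if "i < p" for i using bij_betw_lessThan(1)[OF bij that] .
  have w0: "w 0 = 0" using prim p by (auto simp: prim_order_def)
  have w1: "w i \<le> 1" if "i < p" for i
  proof -
    consider "w i = 0" | k where "k < i" "w i = ?c (\<pi> k) (\<pi> i)"
      using prim \<open>i < p\<close> unfolding prim_order_def by blast
    then show ?thesis
    proof cases
      case 2
      then show ?thesis using corr[of "\<pi> k" "\<pi> i"] \<pi> that by simp
    qed simp
  qed
  have "transpose_mat S $$ (i, j) = S $$ (j, i)" if "i < p" "j < p" for i j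
    using S that by simp
  then have "S $$ (i, j) = S $$ (j, i)" if "i < p" "j < p" for i j
    using pd that unfolding pos_def_mat_def by metis
  then have sym: "?c i j = ?c j i" if "i < p" "j < p" for i j
    using S that by (simp add: emp_corr_def mult.commute)
  define B where "B k = threshold_partition S (real k / real p)" for k
  define ok where "ok k \<longleftrightarrow> (\<forall>b\<in>B k. card b \<le> m)" for k
  define val where "val k = crit \<kappa> S (B k) - 1" for k
  \<comment> \<open>Any labelling that names each group by its first position will do.\<close>
  define lab where "lab k x = level_start p w k (the_inv_into {..<p} \<pi> x)" for k x
  have lab: "lab k (\<pi> i) = level_start p w k i" if "i < p" for k i
    using that the_inv_into_f_f[OF inj] by (simp add: lab_def)
  have B: "B k = label_partition p l" if "\<And>i. i < p \<Longrightarrow> l (\<pi> i) = level_start p w k i" for k l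
    unfolding B_def by (rule threshold_partition_eq[OF S refl sym prim that]) simp_all
  have B_lab: "B k = label_partition p (lab k)" for k
    by (rule B) (rule lab)
  have ok_iff: "ok k \<longleftrightarrow> (\<forall>i<p. i - level_start p w k i < m)" for k
    unfolding ok_def B_lab by (rule card_label_class_le_iff[OF bij lab])
  have val_eq: "V p = val k"
    if "V 0 = 0" and "\<And>i. i < p \<Longrightarrow> V (Suc i) = V (level_start p w k i) +
      seg_term p \<kappa> S \<pi> (level_start p w k i) (Suc i - level_start p w k i)" for k V
  proof -
    have "block_structure (block_restrict S (label_partition p (lab k))) = label_partition p (lab k)"
      by (rule block_structure_block_restrict_threshold[OF S _ B_lab[unfolded B_def]]) simp
    then have "crit \<kappa> S (label_partition p (lab k)) = V p + 1"
      using that by (intro crit_label_partition[OF S pd p bij lab])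
    then show ?thesis by (simp add: val_def B_lab)
  qed
  have ok_p: "ok p"
  proof -
    have "level_start p w p i = i" if "i < p" for i
      using that w1[of i] p by (cases i) auto
    then show ?thesis using m by (simp add: ok_iff)
  qed
  have ok_mono: "ok k'" if "ok k" "k \<le> k'" for k k'
  proof -
    have "level_start p w k i \<le> level_start p w k' i" for i
    proof (rule seg_start_mono_cut)
      have "real k / real p \<le> real k' / real p" using that by (simp add: divide_right_mono)
      then show "cut_at w (real k / real p) i \<Longrightarrow> cut_at w (real k' / real p) i" for i by linarith
    qed
    then show ?thesis using that(1) unfolding ok_iff by (meson diff_le_mono2 le_less_trans)
  qed
  have dim: "dim_row S = p" using S by simp
  have start: "start_index m S = (LEAST k. ok k)"
    unfolding start_index_def ok_def B_def dim ..
  have "start_index m S \<le> k \<longleftrightarrow> ok k" for k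
    unfolding start using ok_p ok_mono by (metis LeastI Least_le)
  then have grid: "threshold_partition S ` threshold_grid m S = {B k | k. k \<le> p \<and> ok k}"
    unfolding threshold_grid_def B_def dim by auto
  show "runs n (Seq (select_level D m) write_labels) \<tau>1
      (\<lambda>\<tau>. is_block_estimate m \<kappa> S (output_partition p \<tau>))"
  proof (rule runs_Seq, rule runs_select_level[where ok = ok and val = val, OF rd n _ w0 D \<pi> _ _ ok_p])
    show "0 < p" using p by simp
    show "ok k \<longleftrightarrow> (\<forall>i<p. i - level_start p w k i < m)" for k by (rule ok_iff)
    show "V p = val k" if "V 0 = 0" and "\<And>i. i < p \<Longrightarrow> V (Suc i) = V (level_start p w k i) +
      seg_term p \<kappa> S \<pi> (level_start p w k i) (Suc i - level_start p w k i)" for k V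
      by (rule val_eq[OF that])
  next
    fix \<tau>2
    assume rd2: "ready p \<kappa> S \<pi> w \<tau>2" and best: "ivar \<tau>2 6 \<le> p" "ok (ivar \<tau>2 6)"
      and least: "\<And>k. k \<le> p \<Longrightarrow> ok k \<Longrightarrow> val (ivar \<tau>2 6) \<le> val k"
    show "runs n write_labels \<tau>2 (\<lambda>\<tau>. is_block_estimate m \<kappa> S (output_partition p \<tau>))"
    proof (rule runs_write_labels[OF rd2 _ w0 inj])
      show "p \<le> n" using n by simp
    next
      fix \<tau> :: store
      assume "\<And>i. i < p \<Longrightarrow> iarr \<tau> 0 (\<pi> i) 0 = level_start p w (ivar \<tau>2 6) i"
      then have "output_partition p \<tau> = B (ivar \<tau>2 6)"
        unfolding output_partition_eq by (intro B[symmetric])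
      then show "is_block_estimate m \<kappa> S (output_partition p \<tau>)"
        using best least unfolding is_block_estimate_def grid is_arg_min_linorder
        by (auto simp: val_def)
    qed
  qed
qed

theorem proposition6:
  fixes m :: nat
  assumes "1 \<le> m"
  shows "\<exists>(prog :: com) (T :: nat \<Rightarrow> nat).
    (\<lambda>p. real (T p)) \<in> O(\<lambda>p. (real p)\<^sup>2) \<and>
    (\<forall>(p :: nat) (n :: nat) (X :: nat \<Rightarrow> real vec) (S :: real mat) (\<kappa> :: real) (\<sigma> :: store).
       1 \<le> p \<and> 1 \<le> n \<and> (\<forall>l<n. X l \<in> carrier_vec p) \<and> S = emp_cov p n X \<and> pos_def_mat S \<and>
       0 \<le> \<kappa> \<and> holds_input p \<kappa> S \<sigma> \<longrightarrow>
       (\<exists>t \<sigma>'. exec prog \<sigma> t \<sigma>' \<and> t \<le> T p \<and>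
          is_block_estimate m \<kappa> S (output_partition p \<sigma>')))"
proof -
  obtain D where D: "\<And>l \<tau>. rval (D l) \<tau> = det (mat l l (\<lambda>(u, v). rval (entry_exp u v) \<tau>))"
    using det_expressible[of _ entry_exp] by metis
  let ?prog = "block_prog D m"
  \<comment> \<open>The scan over the levels makes \<open>p + 1\<close> iterations, all other loops \<open>p\<close>.\<close>
  let ?T = "\<lambda>p. budget (Suc p) ?prog"
  have "?T p \<le> budget 1 ?prog * 4 * p\<^sup>2" if "1 \<le> p" for p
  proof -
    have "?T p \<le> budget 1 ?prog * (Suc p)\<^sup>2"
      using budget_le_power[of "Suc p" ?prog] by (simp only: loop_depth_block_prog)
    moreover have "(Suc p)\<^sup>2 \<le> (2 * p)\<^sup>2" using that by (intro power_mono) simp_all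
    then have "budget 1 ?prog * (Suc p)\<^sup>2 \<le> budget 1 ?prog * (4 * p\<^sup>2)"
      by (intro mult_le_mono2) (simp add: power_mult_distrib)
    ultimately have "?T p \<le> budget 1 ?prog * (4 * p\<^sup>2)" by (rule le_trans)
    then show ?thesis by (simp only: mult.assoc)
  qed
  then have "real (?T p) \<le> real (budget 1 ?prog * 4) * (real p)\<^sup>2" if "1 \<le> p" for p
    using that by (metis of_nat_le_iff of_nat_mult of_nat_power)
  then have "(\<lambda>p. real (?T p)) \<in> O(\<lambda>p. (real p)\<^sup>2)"
    by (intro bigoI[where c = "real (budget 1 ?prog * 4)"] eventually_mono[OF eventually_ge_at_top[of 1]])
      simp
  moreover have "\<exists>t \<sigma>'. exec ?prog \<sigma> t \<sigma>' \<and> t \<le> ?T p \<and>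
      is_block_estimate m \<kappa> S (output_partition p \<sigma>')"
    if "1 \<le> p" "S = emp_cov p n X" "pos_def_mat S" "holds_input p \<kappa> S \<sigma>" for p n X S \<kappa> \<sigma>
  proof -
    have "S \<in> carrier_mat p p" using that(2) by (simp add: emp_cov_def)
    moreover have "\<bar>emp_corr S $$ (i, j)\<bar> \<le> 1" if "i < p" "j < p" for i j
      using abs_emp_corr_le_1[OF that] \<open>S = emp_cov p n X\<close> by simp
    ultimately have "runs (Suc p) ?prog \<sigma> (\<lambda>\<tau>. is_block_estimate m \<kappa> S (output_partition p \<tau>))"
      using runs_block_prog[OF assms that(1) order.refl _ that(3) _ D that(4)] by blast
    then show ?thesis unfolding runs_def by blast
  qed
  ultimately show ?thesis by (intro exI[of _ ?prog] exI[of _ ?T]) blast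
qed

end
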